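(* Let $G$ be a nontrivial strongly regular graph with parameters $(v,k,\lambda,\mu)$, fix any total ordering of $E(G)$ and any field $\Bbbk$, and let $$\beta=\frac{vk}{2}-v+1$$ be its cycle rank. Let $h_G(z)=\sum_i h_i z^i$ be the $h$-polynomial of the broken-circuit complex $\mathrm{BC}(G)$. Then $$h_0=1,\qquad h_1=\beta=\frac{vk}{2}-v+1,\qquad h_2=\binom{\beta+1}{2}-\frac{vk\lambda}{6}.$$ Moreover, $$\dim\Bbbk[\mathrm{BC}(G)]=v-1,\qquad \operatorname{codim}\Bbbk[\mathrm{BC}(G)]=\beta.$$
   Context: A strongly regular graph with parameters $(v,k,\lambda,\mu)$ is a finite simple $k$-regular graph on $v$ vertices in which any two adjacent vertices have exactly $\lambda$ common neighbours and any two distinct nonadjacent vertices have exactly $\mu$ common neighbours. Nontrivial means here that the graph is connected and not complete. For a finite connected loopless graph $G$ with a fixed total order on $E(G)$, a broken circuit is a set $C\setminus\{\max C\}$, where $C$ is the edge set of a cycle of $G$ and $\max C$ is its largest edge. The broken-circuit complex $\mathrm{BC}(G)$ is the simplicial complex on $E(G)$ whose faces are the edge sets containing no broken circuit. Its Stanley--Reisner ring is $\Bbbk[\mathrm{BC}(G)]=\Bbbk[x_e:e\in E(G)]/I_{\mathrm{BC}(G)}$, with $I_{\mathrm{BC}(G)}$ generated by the monomials $\prod_{e\in C\setminus\{\max C\}}x_e$ over all cycles $C$ of $G$. Here $\dim$ is Krull dimension and $\operatorname{codim}\Bbbk[\mathrm{BC}(G)]=|E(G)|-\dim\Bbbk[\mathrm{BC}(G)]$.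 With $r=|V(G)|-1$ and $b_i$ the number of faces of $\mathrm{BC}(G)$ having exactly $i$ elements, the $h$-polynomial of $\mathrm{BC}(G)$ is $h_G(z)=\sum_{i=0}^{r}b_i z^i(1-z)^{r-i}$. *)

theory Defs
  imports
    Complex_Main
    "HOL-Library.Extended_Real"
    "HOL-Library.Poly_Mapping"
    "HOL-Computational_Algebra.Polynomial"
    "HOL-Algebra.QuotRing"
begin

section \<open>Graphs\<close>

text \<open>A simple graph is given by a vertex set and a set of two-element sets of vertices.\<close>

definition simple_graph :: "'a set \<Rightarrow> 'a set set \<Rightarrow> bool" where
  "simple_graph V E \<longleftrightarrow> finite V \<and> (\<forall>e\<in>E. e \<subseteq> V \<and> card e = 2)"

definition neighbours :: "'a set \<Rightarrow> 'a set set \<Rightarrow> 'a \<Rightarrow> 'a set" where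
  "neighbours V E u = {w \<in> V. {u, w} \<in> E}"

definition strongly_regular_graph ::
    "'a set \<Rightarrow> 'a set set \<Rightarrow> nat \<Rightarrow> nat \<Rightarrow> nat \<Rightarrow> nat \<Rightarrow> bool" where
  "strongly_regular_graph V E v k l m \<longleftrightarrow>
     simple_graph V E \<and> card V = v \<and>
     (\<forall>u\<in>V. card (neighbours V E u) = k) \<and>
     (\<forall>u\<in>V. \<forall>w\<in>V. {u, w} \<in> E \<longrightarrow>
        card (neighbours V E u \<inter> neighbours V E w) = l) \<and>
     (\<forall>u\<in>V. \<forall>w\<in>V. u \<noteq> w \<and> {u, w} \<notin> E \<longrightarrow>
        card (neighbours V E u \<inter> neighbours V E w) = m)"

definition joined_by_walk :: "'a set \<Rightarrow> 'a set set \<Rightarrow> ('a \<times> 'a) set" where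
  "joined_by_walk V E = {(u, w). {u, w} \<in> E}\<^sup>* \<inter> V \<times> V"

text \<open>The graph without vertices does not count as connected.\<close>

definition connected_graph :: "'a set \<Rightarrow> 'a set set \<Rightarrow> bool" where
  "connected_graph V E \<longleftrightarrow> V \<noteq> {} \<and> joined_by_walk V E = V \<times> V"

definition complete_graph :: "'a set \<Rightarrow> 'a set set \<Rightarrow> bool" where
  "complete_graph V E \<longleftrightarrow> (\<forall>u\<in>V. \<forall>w\<in>V. u \<noteq> w \<longrightarrow> {u, w} \<in> E)"

definition nontrivial_graph :: "'a set \<Rightarrow> 'a set set \<Rightarrow> bool" where
  "nontrivial_graph V E \<longleftrightarrow> connected_graph V E \<and> \<not> complete_graph V E"

text \<open>Number of edges, minus number of vertices, plus number of connected components.\<close>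

definition cycle_rank :: "'a set \<Rightarrow> 'a set set \<Rightarrow> int" where
  "cycle_rank V E = int (card E) - int (card V) + int (card (V // joined_by_walk V E))"

definition is_cycle :: "'a set \<Rightarrow> 'a set set \<Rightarrow> 'a set set \<Rightarrow> bool" where
  "is_cycle V E C \<longleftrightarrow> C \<subseteq> E \<and>
     (\<exists>xs. distinct xs \<and> 3 \<le> length xs \<and> set xs \<subseteq> V \<and>
        C = {{xs ! i, xs ! (Suc i mod length xs)} | i. i < length xs})"


section \<open>The broken-circuit complex\<close>

text \<open>
  The order on the edges is a relation \<open>r\<close>; \<open>(a, b) \<in> r\<close> means that \<open>a\<close> is at most \<open>b\<close>.
\<close>

definition broken_circuits ::
    "'a set \<Rightarrow> 'a set set \<Rightarrow> 'a set rel \<Rightarrow> 'a set set set" where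
  "broken_circuits V E r =
     {C - {m} | C m. is_cycle V E C \<and> m \<in> C \<and> (\<forall>e\<in>C. (e, m) \<in> r)}"

definition bc_complex :: "'a set \<Rightarrow> 'a set set \<Rightarrow> 'a set rel \<Rightarrow> 'a set set set" where
  "bc_complex V E r = {F. F \<subseteq> E \<and> (\<forall>B \<in> broken_circuits V E r. \<not> B \<subseteq> F)}"

definition h_polynomial :: "'a set \<Rightarrow> 'a set set \<Rightarrow> 'a set rel \<Rightarrow> int poly" where
  "h_polynomial V E r =
     (let d = card V - 1;
          b = (\<lambda>i. card {F \<in> bc_complex V E r. card F = i});
          z = [:0, 1:]
      in \<Sum>i\<le>d. of_nat (b i) * z ^ i * (1 - z) ^ (d - i))"


section \<open>The Stanley--Reisner ring and its dimension\<close>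

text \<open>
  Monomials are finitely supported exponent vectors \<open>'e \<Rightarrow>\<^sub>0 nat\<close>, polynomials are finitely
  supported families of coefficients indexed by monomials. Since the type \<open>'e\<close> may have
  elements outside the set \<open>X\<close> of variables, \<open>mpoly_ring X\<close> keeps only the polynomials in
  which no other variable occurs.
\<close>

type_synonym ('e, 'k) mpoly = "('e \<Rightarrow>\<^sub>0 nat) \<Rightarrow>\<^sub>0 'k"

definition mpoly_ring :: "'e set \<Rightarrow> ('e, 'k::field) mpoly ring" where
  "mpoly_ring X =
     \<lparr>carrier = {p. \<forall>t \<in> Poly_Mapping.keys p. Poly_Mapping.keys t \<subseteq> X},
      mult = (*), one = 1, zero = 0, add = (+)\<rparr>"

definition mpoly_var :: "'e \<Rightarrow> ('e, 'k::field) mpoly" where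
  "mpoly_var e = Poly_Mapping.single (Poly_Mapping.single e 1) 1"

definition bc_ideal ::
    "'a set \<Rightarrow> 'a set set \<Rightarrow> 'a set rel \<Rightarrow> ('a set, 'k::field) mpoly set" where
  "bc_ideal V E r =
     Idl\<^bsub>mpoly_ring E\<^esub> ((\<lambda>B. \<Prod>e\<in>B. mpoly_var e) ` broken_circuits V E r)"

definition bc_ring ::
    "'a set \<Rightarrow> 'a set set \<Rightarrow> 'a set rel \<Rightarrow> ('a set, 'k::field) mpoly set ring" where
  "bc_ring V E r = mpoly_ring E Quot bc_ideal V E r"

text \<open>
  The supremum of the lengths of chains of prime ideals; it is \<open>-\<infinity>\<close> when there are none.
\<close>

definition krull_dim :: "('a, 'b) ring_scheme \<Rightarrow> ereal" where
  "krull_dim R = Sup {ereal (real n) | n.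
     \<exists>P. (\<forall>i\<le>n. primeideal (P i) R) \<and> (\<forall>i<n. P i \<subset> P (Suc i))}"

end

theory Submission
  imports Defs
begin

text \<open>
  A face of the broken-circuit complex contains no cycle, so it has at most \<open>|V| - 1\<close> edges, and
  the edges that are not minimal in any cycle form a face that connects all vertices. Broken
  circuits have at least two edges, and those with exactly two correspond to triangles; this gives
  the numbers of faces with at most two elements and with them \<open>h\<^sub>0\<close>, \<open>h\<^sub>1\<close>, \<open>h\<^sub>2\<close>.

  For a prime ideal \<open>Q\<close> containing the Stanley--Reisner ideal, the edges whose variable is not in
  \<open>Q\<close> form a face. Given a chain of primes \<open>Q\<^sub>0 \<subset> \<dots> \<subset> Q\<^sub>n\<close>, elements \<open>f\<^sub>i \<in> Q\<^sub>i\<^sub>+\<^sub>1 - Q\<^sub>i\<close> are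
  algebraically independent over the field modulo \<open>Q\<^sub>0\<close>, where they may be taken to involve only the
  variables of that face. Comparing the number of products of powers of the \<open>f\<^sub>i\<close> with the number
  of monomials of the same degree shows that \<open>n\<close> is at most the size of the face. Conversely, a
  decreasing chain of faces gives an increasing chain of monomial primes.
\<close>

section \<open>Cycles and edge counts\<close>

lemma simple_graph_finite_vertices: "simple_graph V E \<Longrightarrow> finite V"
  by (simp add: simple_graph_def)

lemma simple_graph_finite_edges: "simple_graph V E \<Longrightarrow> finite E"
  unfolding simple_graph_def by (meson PowI finite_Pow_iff finite_subset subsetI)

lemma simple_graph_subset: "simple_graph V E \<Longrightarrow> F \<subseteq> E \<Longrightarrow> simple_graph V F"
  by (auto simp: simple_graph_def)

lemma simple_graph_edgeD:
  assumes "simple_graph V E" "{a, b} \<in> E"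
  shows "a \<in> V" "b \<in> V" "a \<noteq> b"
  using assms by (auto simp: simple_graph_def card_insert_if split: if_splits)

lemma simple_graph_edgeE:
  assumes "simple_graph V E" "e \<in> E"
  obtains a b where "e = {a, b}" "a \<noteq> b" "a \<in> V" "b \<in> V"
  using assms unfolding simple_graph_def by (metis card_2_iff insert_subset)

lemma is_cycle_mono: "is_cycle V F C \<Longrightarrow> V \<subseteq> V' \<Longrightarrow> F \<subseteq> F' \<Longrightarrow> is_cycle V' F' C"
  unfolding is_cycle_def by (elim conjE exE, intro conjI exI) (assumption | rule subset_trans)+

lemma is_cycle_edges: "is_cycle V E C \<Longrightarrow> C \<subseteq> E"
  by (simp add: is_cycle_def)

text \<open>If two positions gave the same edge, each would be the cyclic successor of the other,
  which is impossible in length at least three. This makes the number of edges of a cycle equal to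
  the number of its vertices.\<close>

lemma inj_on_cycle_edge:
  assumes "distinct xs" "3 \<le> length xs"
  shows "inj_on (\<lambda>i. {xs ! i, xs ! (Suc i mod length xs)}) {..<length xs}"
proof (rule inj_onI)
  fix i j
  let ?n = "length xs"
  assume ij: "i \<in> {..<?n}" "j \<in> {..<?n}"
    and eq: "{xs ! i, xs ! (Suc i mod ?n)} = {xs ! j, xs ! (Suc j mod ?n)}"
  have less: "Suc k mod ?n < ?n" for k
    using assms by (intro mod_less_divisor) auto
  show "i = j"
  proof (rule ccontr)
    assume "i \<noteq> j"
    then have "i = Suc j mod ?n" "Suc i mod ?n = j"
      using eq ij less assms(1) by (auto simp: doubleton_eq_iff nth_eq_iff_index_eq)
    then show False
      using ij assms(2) by (auto simp: mod_Suc split: if_splits)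
  qed
qed

lemma is_cycleE:
  assumes "is_cycle V E C"
  obtains xs where "distinct xs" "3 \<le> length xs" "set xs \<subseteq> V" "C \<subseteq> E"
    "C = (\<lambda>i. {xs ! i, xs ! (Suc i mod length xs)}) ` {..<length xs}" "card C = length xs"
proof -
  obtain xs where xs: "distinct xs" "3 \<le> length xs" "set xs \<subseteq> V" "C \<subseteq> E"
    and C: "C = {{xs ! i, xs ! (Suc i mod length xs)} | i. i < length xs}"
    using assms unfolding is_cycle_def by blast
  have "C = (\<lambda>i. {xs ! i, xs ! (Suc i mod length xs)}) ` {..<length xs}"
    unfolding C by auto
  then show ?thesis
    using that[OF xs] card_image[OF inj_on_cycle_edge[OF xs(1,2)]] by simp
qed

lemma card_cycle_ge: "is_cycle V E C \<Longrightarrow> 3 \<le> card C"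
  by (erule is_cycleE) simp

lemma is_cycle_triangle:
  assumes "simple_graph V E" "{a, b} \<in> E" "{b, c} \<in> E" "{c, a} \<in> E"
  shows "is_cycle V E {{a, b}, {b, c}, {c, a}}"
proof -
  have *: "{{[a, b, c] ! i, [a, b, c] ! (Suc i mod length [a, b, c])} | i. i < length [a, b, c]}
      = {{a, b}, {b, c}, {c, a}}"
  proof -
    have "{f i | i. i < length [a, b, c]} = {f 0, f 1, f 2}" for f :: "nat \<Rightarrow> 'a set"
      by (auto simp: numeral_2_eq_2 less_Suc_eq)
    then show ?thesis
      by simp
  qed
  show ?thesis
    unfolding is_cycle_def
  proof (intro conjI exI[of _ "[a, b, c]"])
    show "distinct [a, b, c]" "set [a, b, c] \<subseteq> V"
      using simple_graph_edgeD[OF assms(1,2)] simple_graph_edgeD[OF assms(1,3)]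
        simple_graph_edgeD[OF assms(1,4)] by auto
  qed (use assms in simp, simp, rule *[symmetric])
qed

lemma is_cycle_card_3E:
  assumes "is_cycle V E C" "card C = 3"
  obtains a b c where "C = {{a, b}, {b, c}, {c, a}}" "distinct [a, b, c]" "{a, b, c} \<subseteq> V"
proof -
  obtain xs where xs: "distinct xs" "set xs \<subseteq> V" "length xs = 3"
    and C: "C = (\<lambda>i. {xs ! i, xs ! (Suc i mod length xs)}) ` {..<length xs}"
  proof (rule is_cycleE[OF assms(1)])
  qed (use assms(2) that in auto)
  obtain a b c where abc: "xs = [a, b, c]"
    using xs(3) by (auto simp: numeral_3_eq_3 length_Suc_conv)
  have "{..<3 :: nat} = {0, 1, 2}"
    by auto
  then have "C = {{a, b}, {b, c}, {c, a}}"
    unfolding C xs(3) by (simp add: abc)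
  moreover have "distinct [a, b, c]" "{a, b, c} \<subseteq> V"
    using xs by (simp_all add: abc)
  ultimately show ?thesis
    by (rule that)
qed

text \<open>All neighbours of an end of a longest path lie on that path. A second edge at this end
  therefore leads back to the path and closes a cycle.\<close>

lemma exists_cycle_min_degree:
  assumes G: "simple_graph V F" and "V \<noteq> {}"
    and deg: "\<And>u. u \<in> V \<Longrightarrow> 2 \<le> card {e \<in> F. u \<in> e}"
  shows "\<exists>C. is_cycle V F C"
proof -
  define path where "path xs \<longleftrightarrow> xs \<noteq> [] \<and> distinct xs \<and> set xs \<subseteq> V \<and>
    (\<forall>i. Suc i < length xs \<longrightarrow> {xs ! i, xs ! Suc i} \<in> F)" for xs
  have "length xs \<le> card V" if "path xs" for xs
    using that G by (metis path_def simple_graph_def card_mono distinct_card)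
  moreover obtain v where "v \<in> V"
    using \<open>V \<noteq> {}\<close> by auto
  then have "path [v]"
    by (simp add: path_def)
  ultimately obtain xs where xs: "path xs" and max: "\<And>ys. path ys \<Longrightarrow> length ys \<le> length xs"
    using ex_has_greatest_nat[of path "[v]" length "Suc (card V)"] by (metis le_imp_less_Suc)
  define x where "x = xs ! 0"
  have "x \<in> V"
    using xs by (auto simp: path_def x_def)
  \<comment> \<open>If the other end of \<open>e\<close> were not on the path, it could be put in
    front of \<open>xs\<close>, contradicting maximality.\<close>
  have pos: "\<exists>j<length xs. 0 < j \<and> {x, xs ! j} = e" if e: "e \<in> F" "x \<in> e" for e
  proof -
    obtain w where w: "e = {x, w}" "w \<noteq> x"
    proof -
      obtain p q where "e = {p, q}" "p \<noteq> q"
        using simple_graph_edgeE[OF G e(1)] by metis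
      then show ?thesis
        using that[of q] that[of p] e(2) by auto
    qed
    then have "w \<in> V"
      using simple_graph_edgeD(2)[OF G] e by auto
    have "w \<in> set xs"
    proof (rule ccontr)
      assume "w \<notin> set xs"
      have "{(w # xs) ! i, (w # xs) ! Suc i} \<in> F" if "Suc i < length (w # xs)" for i
        using that xs w e by (cases i) (auto simp: path_def x_def insert_commute)
      then have "path (w # xs)"
        using xs \<open>w \<in> V\<close> \<open>w \<notin> set xs\<close> by (simp add: path_def)
      then show False
        using max by fastforce
    qed
    then obtain j where "j < length xs" "xs ! j = w"
      by (auto simp: in_set_conv_nth)
    then show ?thesis
      using w by (intro exI[of _ j]) (auto simp: x_def intro: gr0I)
  qed
  have "\<not> card {e \<in> F. x \<in> e} \<le> 1"
    using deg[OF \<open>x \<in> V\<close>] by simp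
  then obtain e1 e2 where e: "e1 \<in> F" "x \<in> e1" "e2 \<in> F" "x \<in> e2" "e1 \<noteq> e2"
    using simple_graph_finite_edges[OF G] by (auto simp: card_le_Suc0_iff_eq)
  \<comment> \<open>Only one of the two edges at \<open>x\<close> can go to position 1. The other
    one reaches position 2 or later, so the cycle it closes has at least three vertices.\<close>
  obtain j where j: "j < length xs" "2 \<le> j" "{x, xs ! j} \<in> F"
  proof -
    obtain j1 j2 where "j1 < length xs" "0 < j1" "{x, xs ! j1} = e1"
        "j2 < length xs" "0 < j2" "{x, xs ! j2} = e2"
      using pos e by metis
    then show ?thesis
      using e that[of j1] that[of j2] by (cases "2 \<le> j1"; cases "2 \<le> j2") (auto simp: not_le less_Suc_eq numeral_2_eq_2)
  qed
  define ys where "ys = take (Suc j) xs"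
  have len: "length ys = Suc j"
    using j by (simp add: ys_def)
  have "is_cycle V F {{ys ! i, ys ! (Suc i mod length ys)} | i. i < length ys}"
    unfolding is_cycle_def
  proof (intro conjI exI[of _ ys] refl)
    show "{{ys ! i, ys ! (Suc i mod length ys)} | i. i < length ys} \<subseteq> F"
    proof clarify
      fix i assume i: "i < length ys"
      show "{ys ! i, ys ! (Suc i mod length ys)} \<in> F"
      proof (cases "i = j")
        case True
        then show ?thesis
          using j by (simp add: len) (simp add: ys_def x_def insert_commute)
      next
        case False
        then show ?thesis
          using i j xs by (simp add: len) (simp add: ys_def path_def)
      qed
    qed
    show "distinct ys" "set ys \<subseteq> V"
      using xs set_take_subset[of "Suc j" xs] by (auto simp: ys_def path_def)
  qed (use j len in auto)
  then show ?thesis by blast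
qed

text \<open>Deleting a vertex of degree at most one costs one vertex and at most one edge, so the
  inequality survives until every degree is at least two.\<close>

lemma exists_cycle_if_many_edges:
  assumes "simple_graph V F" "V \<noteq> {}" "card V \<le> card F"
  shows "\<exists>C. is_cycle V F C"
  using assms
proof (induction "card V" arbitrary: V F rule: less_induct)
  case less
  have finV: "finite V" and finF: "finite F"
    using less.prems by (simp_all add: simple_graph_finite_vertices simple_graph_finite_edges)
  show ?case
  proof (cases "\<forall>u\<in>V. 2 \<le> card {e \<in> F. u \<in> e}")
    case True
    then show ?thesis
      using exists_cycle_min_degree less.prems by blast
  next
    case False
    then obtain u where u: "u \<in> V" "card {e \<in> F. u \<in> e} \<le> 1"
      by fastforce
    define F' where "F' = {e \<in> F. u \<notin> e}"
    have "F = F' \<union> {e \<in> F. u \<in> e}"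
      by (auto simp: F'_def)
    then have "card F \<le> card F' + card {e \<in> F. u \<in> e}"
      by (metis card_Un_le)
    then have F': "card V - 1 \<le> card F'"
      using u less.prems by simp
    have G': "simple_graph (V - {u}) F'"
      using less.prems(1) by (auto simp: simple_graph_def F'_def)
    \<comment> \<open>A single vertex carries no edge, whereas \<open>F\<close> has at least
      \<open>card V\<close> of them.\<close>
    have "V - {u} \<noteq> {}"
    proof
      assume "V - {u} = {}"
      then have "V = {u}" using u by auto
      then have "F = {}"
        using less.prems(1) simple_graph_edgeE by (metis equals0I singletonD)
      then show False
        using less.prems \<open>V = {u}\<close> by simp
    qed
    moreover have "card (V - {u}) < card V"
      using u finV by (intro psubset_card_mono) auto
    ultimately obtain C where "is_cycle (V - {u}) F' C"
      using less.hyps[of "V - {u}" F'] G' F' u finV by auto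
    then show ?thesis
      using is_cycle_mono[of "V - {u}" F' C V F] by (auto simp: F'_def)
  qed
qed

text \<open>A vertex set is grown from a single vertex. As long as it is not all of
  \<open>V\<close>, some edge leaves it, and each added vertex is paid for by such an edge.\<close>

lemma card_le_Suc_edges_if_connected:
  assumes G: "simple_graph V T" and conn: "\<And>a b. a \<in> V \<Longrightarrow> b \<in> V \<Longrightarrow> (a, b) \<in> {(a, b). {a, b} \<in> T}\<^sup>*"
  shows "card V \<le> Suc (card T)"
proof -
  let ?R = "{(a, b). {a, b} \<in> T}"
  have finV: "finite V" and finT: "finite T"
    using G by (simp_all add: simple_graph_finite_vertices simple_graph_finite_edges)
  \<comment> \<open>Since the edges collected in \<open>T'\<close> lie inside \<open>S\<close>, an
    edge that leaves \<open>S\<close> is new.\<close>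
  have grow: "\<exists>S T'. S \<subseteq> V \<and> T' \<subseteq> T \<and> card S = Suc n \<and> card T' = n \<and> (\<forall>e\<in>T'. e \<subseteq> S)"
    if "Suc n \<le> card V" for n
    using that
  proof (induction n)
    case 0
    then obtain v where "v \<in> V"
      by (metis card.empty equals0I not_less_eq_eq le0)
    then show ?case
      by (intro exI[of _ "{v}"] exI[of _ "{}"]) auto
  next
    case (Suc n)
    then obtain S T' where S: "S \<subseteq> V" "T' \<subseteq> T" "card S = Suc n" "card T' = n" "\<forall>e\<in>T'. e \<subseteq> S"
      by auto
    obtain s where "s \<in> S"
      using S(3) by fastforce
    have "S \<noteq> V"
      using S Suc.prems by auto
    then obtain w where w: "w \<in> V" "w \<notin> S"
      using S by auto
    obtain a b where ab: "a \<in> S" "b \<notin> S" "{a, b} \<in> T"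
    proof (rule ccontr)
      assume no: "\<not> thesis"
      \<comment> \<open>If no edge of \<open>T\<close> left \<open>S\<close>, the walk from
        \<open>s\<close> could never reach \<open>w\<close>.\<close>
      have "(s, w) \<in> ?R\<^sup>*"
        using conn S \<open>s \<in> S\<close> w by auto
      then have "w \<in> S"
      proof (induction rule: rtrancl_induct)
        case (step y z)
        then show ?case using no that by blast
      qed (rule \<open>s \<in> S\<close>)
      then show False using w by simp
    qed
    have "b \<in> V"
      using simple_graph_edgeD[OF G ab(3)] by simp
    have "finite S" "finite T'"
      using S finV finT finite_subset by blast+
    moreover have "{a, b} \<notin> T'"
      using S ab by auto
    ultimately show ?case
      using S ab \<open>b \<in> V\<close>
      by (intro exI[of _ "insert b S"] exI[of _ "insert {a, b} T'"]) auto
  qed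
  show ?thesis
  proof (cases "card V")
    case (Suc n)
    then obtain T' where "T' \<subseteq> T" "card T' = n"
      using grow[of n] by auto
    then show ?thesis
      using Suc card_mono[OF finT] by fastforce
  qed simp
qed

lemma linear_order_on_has_max:
  assumes "linear_order_on A r" "finite C" "C \<noteq> {}" "C \<subseteq> A"
  shows "\<exists>m\<in>C. \<forall>e\<in>C. (e, m) \<in> r"
proof -
  have r: "(x, x) \<in> r" if "x \<in> A" for x
    using assms(1) that by (auto simp: order_on_defs refl_on_def)
  have t: "trans r" and tot: "total_on A r"
    using assms(1) by (auto simp: order_on_defs)
  show ?thesis
    using assms(2-4)
  proof (induction C rule: finite_ne_induct)
    case (singleton x)
    then show ?case using r by simp
  next
    case (insert x C)
    then obtain m where m: "m \<in> C" "\<forall>e\<in>C. (e, m) \<in> r"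
      by auto
    have "(x, m) \<in> r \<or> (m, x) \<in> r"
      using tot insert.prems m r unfolding total_on_def by (metis insert_subset subsetD)
    then show ?case
    proof
      assume "(x, m) \<in> r"
      then show ?thesis using m by auto
    next
      assume "(m, x) \<in> r"
      then have "\<forall>e\<in>insert x C. (e, x) \<in> r"
        using m t r insert.prems by (auto dest: transD)
      then show ?thesis by auto
    qed
  qed
qed

section \<open>Faces of the broken-circuit complex\<close>

context
  fixes V :: "'a set" and E :: "'a set set" and r :: "'a set rel"
  assumes G: "simple_graph V E" and r: "linear_order_on E r"
begin

lemma order_antisym: "(a, b) \<in> r \<Longrightarrow> (b, a) \<in> r \<Longrightarrow> a = b"
  using r by (auto simp: order_on_defs dest: antisymD)

lemma cycle_has_max: "is_cycle V E C \<Longrightarrow> \<exists>m\<in>C. \<forall>e\<in>C. (e, m) \<in> r"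
  using card_cycle_ge[of V E C] simple_graph_finite_edges[OF G] finite_subset[of C E]
  by (intro linear_order_on_has_max[OF r]) (auto simp: is_cycle_def)

lemma cycle_has_min: "is_cycle V E C \<Longrightarrow> \<exists>m\<in>C. \<forall>e\<in>C. (m, e) \<in> r"
  using card_cycle_ge[of V E C] simple_graph_finite_edges[OF G] finite_subset[of C E]
    linear_order_on_has_max[of E "r\<inverse>" C] r is_cycle_edges[of V E C] by fastforce

lemma broken_circuitE:
  assumes "B \<in> broken_circuits V E r"
  obtains C m where "B = C - {m}" "is_cycle V E C" "m \<in> C" "\<forall>e\<in>C. (e, m) \<in> r"
    "card C = Suc (card B)"
proof -
  obtain C m where C: "B = C - {m}" "is_cycle V E C" "m \<in> C" "\<forall>e\<in>C. (e, m) \<in> r"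
    using assms by (auto simp: broken_circuits_def)
  have "finite C"
    using finite_subset[OF is_cycle_edges[OF C(2)] simple_graph_finite_edges[OF G]] .
  then have "card C = Suc (card B)"
    using card_Suc_Diff1[of C m] C(1,3) by simp
  with C show ?thesis
    by (rule that)
qed

lemma broken_circuit_subset: "B \<in> broken_circuits V E r \<Longrightarrow> B \<subseteq> E"
  using is_cycle_edges by (elim broken_circuitE) blast

lemma card_broken_circuit_ge: "B \<in> broken_circuits V E r \<Longrightarrow> 2 \<le> card B"
  using card_cycle_ge by (elim broken_circuitE) fastforce

lemma bc_complex_down_closed: "F \<in> bc_complex V E r \<Longrightarrow> F' \<subseteq> F \<Longrightarrow> F' \<in> bc_complex V E r"
  unfolding bc_complex_def by (blast intro: subset_trans)

text \<open>With \<open>card V\<close> or more edges the face would contain a cycle, and with it the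
  broken circuit obtained by deleting the largest edge.\<close>

lemma card_face_less:
  assumes "V \<noteq> {}" "F \<in> bc_complex V E r"
  shows "card F < card V"
proof (rule ccontr)
  assume "\<not> card F < card V"
  moreover have "F \<subseteq> E"
    using assms by (simp add: bc_complex_def)
  ultimately obtain C where C: "is_cycle V F C"
    using exists_cycle_if_many_edges[OF simple_graph_subset[OF G]] assms(1) not_less by blast
  then have C': "is_cycle V E C"
    using is_cycle_mono \<open>F \<subseteq> E\<close> by blast
  then obtain m where "m \<in> C" "\<forall>e\<in>C. (e, m) \<in> r"
    using cycle_has_max by blast
  then have "C - {m} \<in> broken_circuits V E r"
    using C' by (auto simp: broken_circuits_def)
  moreover have "C - {m} \<subseteq> F"
    using C is_cycle_edges by blast
  ultimately show False
    using assms(2) by (auto simp: bc_complex_def)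
qed

text \<open>The edges that are not the smallest edge of any cycle form the maximum spanning tree.\<close>

lemma exists_spanning_face:
  assumes conn: "connected_graph V E"
  shows "\<exists>F\<in>bc_complex V E r. card V \<le> Suc (card F)"
proof -
  define T where "T = {e \<in> E. \<not> (\<exists>C. is_cycle V E C \<and> e \<in> C \<and> (\<forall>f\<in>C. (e, f) \<in> r))}"
  let ?R = "{(a, b). {a, b} \<in> T}"
  have "T \<subseteq> E"
    by (auto simp: T_def)
  have sym: "(b, a) \<in> ?R\<^sup>*" if "(a, b) \<in> ?R\<^sup>*" for a b
  proof -
    have "sym ?R"
      by (auto simp: sym_def insert_commute)
    then show ?thesis
      using that sym_rtrancl symD by metis
  qed
  \<comment> \<open>Induction from the largest edge downwards. An edge outside \<open>T\<close> is
    the smallest edge of some cycle, so the other edges of this cycle are larger, and their ends are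
    already joined in \<open>T\<close>.\<close>
  have edge: "\<forall>a b. e = {a, b} \<longrightarrow> (a, b) \<in> ?R\<^sup>*" if "e \<in> E" for e
    using that
  proof (induction "card {f \<in> E. (e, f) \<in> r}" arbitrary: e rule: less_induct)
    case less
    show ?case
    proof (cases "e \<in> T")
      case True
      then show ?thesis by auto
    next
      case False
      then obtain C where C: "is_cycle V E C" "e \<in> C" "\<forall>f\<in>C. (e, f) \<in> r"
        using less.prems by (auto simp: T_def)
      have IH: "(a, b) \<in> ?R\<^sup>*" if "{a, b} \<in> C" "{a, b} \<noteq> e" for a b
      proof -
        have f: "{a, b} \<in> E" "(e, {a, b}) \<in> r"
          using that C(3) is_cycle_edges[OF C(1)] by blast+
        have "trans r" "refl_on E r"
          using r by (auto simp: order_on_defs)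
        then have "{f \<in> E. ({a, b}, f) \<in> r} \<subset> {f \<in> E. (e, f) \<in> r}"
          using f that(2) less.prems order_antisym[of e "{a, b}"]
          by (auto dest: transD refl_onD)
        then have "card {f \<in> E. ({a, b}, f) \<in> r} < card {f \<in> E. (e, f) \<in> r}"
          using simple_graph_finite_edges[OF G] by (intro psubset_card_mono) auto
        then show ?thesis
          using less.hyps f by blast
      qed
      obtain xs where xs: "distinct xs" "3 \<le> length xs"
        and Cxs: "C = (\<lambda>i. {xs ! i, xs ! (Suc i mod length xs)}) ` {..<length xs}"
        by (rule is_cycleE[OF C(1)]) (rule that)
      define n where "n = length xs"
      obtain i where i: "i < n" and e: "e = {xs ! i, xs ! (Suc i mod n)}"
        using C(2) by (auto simp: Cxs n_def)
      \<comment> \<open>The detour around \<open>e\<close>: start at its second end and follow the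
        remaining \<open>n - 1\<close> edges of the cycle to its first end.\<close>
      have walk: "(xs ! (Suc i mod n), xs ! ((Suc i + j) mod n)) \<in> ?R\<^sup>*" if "j < n" for j
        using that
      proof (induction j)
        case (Suc j)
        define p where "p = (Suc i + j) mod n"
        have p: "p < n"
          using i by (auto simp: p_def)
        \<comment> \<open>Fewer than \<open>n - 1\<close> steps have been made from position
          \<open>i + 1\<close>, so position \<open>i\<close>, which belongs to \<open>e\<close>, is
          not yet reached.\<close>
        have "p = (if Suc i + j < n then Suc i + j else Suc i + j - n)"
          using i Suc.prems unfolding p_def by (simp add: mod_if)
        then have "p \<noteq> i"
          using i Suc.prems by (auto split: if_splits)
        then have "{xs ! p, xs ! (Suc p mod n)} \<noteq> e"
          using inj_onD[OF inj_on_cycle_edge[OF xs], of p i] p i by (auto simp: e n_def)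
        then have "(xs ! p, xs ! (Suc p mod n)) \<in> ?R\<^sup>*"
          using p by (intro IH) (auto simp: Cxs n_def)
        moreover have "Suc p mod n = (Suc i + Suc j) mod n"
          by (simp add: p_def mod_Suc_eq)
        ultimately show ?case
          using Suc by (simp add: p_def)
      qed simp
      have "(Suc i + (n - 1)) mod n = i"
        using i by simp
      then have "(xs ! (Suc i mod n), xs ! i) \<in> ?R\<^sup>*"
        using walk[of "n - 1"] i by simp
      then show ?thesis
        using sym by (auto simp: e doubleton_eq_iff)
    qed
  qed
  have "(a, b) \<in> ?R\<^sup>*" if "a \<in> V" "b \<in> V" for a b
  proof -
    have "(a, b) \<in> {(u, w). {u, w} \<in> E}\<^sup>*"
      using conn that by (auto simp: connected_graph_def joined_by_walk_def)
    then show ?thesis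
      by (induction rule: rtrancl_induct) (auto dest: edge[rule_format] intro: rtrancl_trans)
  qed
  then have "card V \<le> Suc (card T)"
    using card_le_Suc_edges_if_connected[OF simple_graph_subset[OF G \<open>T \<subseteq> E\<close>]] by blast
  \<comment> \<open>The smallest edge of a cycle is not its largest, so it stays in the broken
    circuit; but it does not belong to \<open>T\<close>.\<close>
  moreover have "T \<in> bc_complex V E r"
    unfolding bc_complex_def
  proof (intro CollectI conjI ballI notI \<open>T \<subseteq> E\<close>)
    fix B assume "B \<in> broken_circuits V E r" "B \<subseteq> T"
    then obtain C m where C: "B = C - {m}" "is_cycle V E C" "m \<in> C" "\<forall>e\<in>C. (e, m) \<in> r"
      using broken_circuitE[OF \<open>B \<in> broken_circuits V E r\<close>] by metis
    obtain e where e: "e \<in> C" "\<forall>f\<in>C. (e, f) \<in> r"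
      using cycle_has_min[OF C(2)] by blast
    have "e \<noteq> m"
    proof
      assume "e = m"
      then have "C \<subseteq> {m}"
        using C(4) e order_antisym by blast
      then have "card C \<le> card {m}"
        by (intro card_mono) auto
      then show False
        using card_cycle_ge[OF C(2)] by simp
    qed
    then have "e \<in> T"
      using e C(1) \<open>B \<subseteq> T\<close> by auto
    then show False
      using e C(2) by (auto simp: T_def)
  qed
  ultimately show ?thesis by blast
qed

section \<open>Faces with at most two elements and the coefficients of the h-polynomial\<close>

lemma faces_0: "{F \<in> bc_complex V E r. card F = 0} = {{}}"
proof -
  have "finite F" if "F \<in> bc_complex V E r" for F
    using that simple_graph_finite_edges[OF G] finite_subset by (auto simp: bc_complex_def)
  moreover have "{} \<in> bc_complex V E r"
    using card_broken_circuit_ge by (fastforce simp: bc_complex_def)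
  ultimately show ?thesis by auto
qed

lemma faces_1: "{F \<in> bc_complex V E r. card F = 1} = {F. F \<subseteq> E \<and> card F = 1}"
proof -
  have "F \<in> bc_complex V E r" if F: "F \<subseteq> E" "card F = 1" for F
    unfolding bc_complex_def
  proof (intro CollectI conjI ballI notI F(1))
    fix B assume "B \<in> broken_circuits V E r" "B \<subseteq> F"
    moreover have "finite F"
      using F simple_graph_finite_edges[OF G] finite_subset by blast
    ultimately show False
      using F card_mono[of F B] card_broken_circuit_ge[of B] by simp
  qed
  then show ?thesis
    by (auto simp: bc_complex_def)
qed

text \<open>A broken circuit has at least two edges, so one that is contained in a pair of edges
  equals this pair.\<close>

lemma faces_2:
  "{F \<in> bc_complex V E r. card F = 2} =
     {F. F \<subseteq> E \<and> card F = 2} - {B \<in> broken_circuits V E r. card B = 2}"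
proof -
  have "F \<in> bc_complex V E r" if F: "F \<subseteq> E" "card F = 2" "F \<notin> broken_circuits V E r" for F
    unfolding bc_complex_def
  proof (intro CollectI conjI ballI notI F(1))
    fix B assume B: "B \<in> broken_circuits V E r" "B \<subseteq> F"
    have "finite F"
      using F simple_graph_finite_edges[OF G] finite_subset by blast
    then have "B = F"
      using F B card_broken_circuit_ge[of B] by (intro card_seteq) auto
    then show False
      using F B by simp
  qed
  then show ?thesis
    by (auto simp: bc_complex_def)
qed

lemma card_faces_2:
  "card {F \<in> bc_complex V E r. card F = 2} + card {B \<in> broken_circuits V E r. card B = 2}
     = card E choose 2"
proof -
  let ?D = "{B \<in> broken_circuits V E r. card B = 2}" and ?P = "{F. F \<subseteq> E \<and> card F = 2}"
  have sub: "?D \<subseteq> ?P"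
    using broken_circuit_subset by blast
  have fin: "finite ?P"
    using simple_graph_finite_edges[OF G] by simp
  have "card (?P - ?D) = card ?P - card ?D"
    using finite_subset[OF sub fin] sub by (rule card_Diff_subset)
  moreover have "card ?D \<le> card ?P"
    using fin sub by (rule card_mono)
  ultimately show ?thesis
    unfolding faces_2 using n_subsets[OF simple_graph_finite_edges[OF G], of 2] by simp
qed

text \<open>The summand with index \<open>i\<close> is divisible by the \<open>i\<close>-th power of
  the variable, so only \<open>i \<le> n\<close> contributes; the remaining factor gives a signed
  binomial coefficient.\<close>

lemma coeff_h_polynomial:
  assumes "n \<le> card V - 1"
  shows "poly.coeff (h_polynomial V E r) n =
    (\<Sum>i\<le>n. int (card {F \<in> bc_complex V E r. card F = i}) *
      ((- 1) ^ (n - i) * int ((card V - 1 - i) choose (n - i))))"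
proof -
  define d where "d = card V - 1"
  have nd: "n - i \<le> d - i" for i
    using assms by (simp add: d_def diff_le_mono)
  define b where "b i = card {F \<in> bc_complex V E r. card F = i}" for i
  have z: "[:0, 1:] ^ i = monom (1 :: int) i" for i
    by (simp add: monom_altdef)
  have one: "1 - [:0, 1:] = [:1, - 1 :: int:]"
    by (simp add: one_pCons)
  have "poly.coeff (h_polynomial V E r) n =
      (\<Sum>i\<le>d. poly.coeff (of_nat (b i) * [:0, 1:] ^ i * (1 - [:0, 1:]) ^ (d - i)) n)"
    by (simp add: h_polynomial_def Let_def coeff_sum d_def b_def)
  also have "\<dots> = (\<Sum>i\<le>d. if i \<le> n then int (b i) * ((- 1) ^ (n - i) * int ((d - i) choose (n - i))) else 0)"
    by (intro sum.cong refl)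
      (simp add: z one of_nat_poly coeff_monom_mult coeff_linear_poly_power[OF nd] mult.assoc)
  also have "\<dots> = (\<Sum>i\<le>n. int (b i) * ((- 1) ^ (n - i) * int ((d - i) choose (n - i))))"
    using assms by (intro sum.mono_neutral_cong_right) (auto simp: d_def)
  finally show ?thesis
    by (simp add: d_def b_def)
qed

end

section \<open>Counting triangles\<close>

lemma card_joined_classes: "connected_graph V E \<Longrightarrow> card (V // joined_by_walk V E) = 1"
proof -
  assume "connected_graph V E"
  then have "V \<noteq> {}" "joined_by_walk V E = V \<times> V"
    by (auto simp: connected_graph_def)
  then have "V // joined_by_walk V E = {V}"
    by (auto simp: quotient_def)
  then show ?thesis by simp
qed

text \<open>Two nonadjacent vertices are joined by a walk, whose first edge leads to a third vertex.
  The bound makes the coefficient formula applicable to the second coefficient.\<close>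

lemma nontrivial_graph_card_ge:
  assumes G: "simple_graph V E" and "nontrivial_graph V E"
  shows "3 \<le> card V"
proof -
  obtain u w where uw: "u \<in> V" "w \<in> V" "u \<noteq> w" "{u, w} \<notin> E"
    using assms by (auto simp: nontrivial_graph_def complete_graph_def)
  have "(u, w) \<in> {(u, w). {u, w} \<in> E}\<^sup>*"
    using assms uw by (auto simp: nontrivial_graph_def connected_graph_def joined_by_walk_def)
  then obtain x where x: "{u, x} \<in> E"
    using uw by (auto elim: converse_rtranclE)
  have "x \<in> V" "x \<noteq> u" "x \<noteq> w"
    using simple_graph_edgeD[OF G x] x uw by auto
  then have "card {u, w, x} = 3"
    using uw by simp
  moreover have "card {u, w, x} \<le> card V"
    using uw \<open>x \<in> V\<close> simple_graph_finite_vertices[OF G] by (intro card_mono) auto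
  ultimately show ?thesis by simp
qed

text \<open>Double counting with constant fibres: used with fibres of size 2 for the orientations of
  an edge and of size 6 for the orderings of a triangle.\<close>

lemma card_eq_fibres:
  assumes "finite S" "\<And>y. y \<in> g ` S \<Longrightarrow> card {x \<in> S. g x = y} = n"
  shows "card S = card (g ` S) * n"
proof -
  have "card S = (\<Sum>y\<in>g ` S. card {x \<in> S. g x = y})"
    using sum.group[of S "g ` S" g "\<lambda>_. 1 :: nat"] assms(1) by simp
  then show ?thesis
    using assms(2) by simp
qed

text \<open>Edges with an orientation, arranged by their first vertex so that degrees can be
  summed.\<close>

definition darts :: "'a set \<Rightarrow> 'a set set \<Rightarrow> ('a \<times> 'a) set" where
  "darts V E = Sigma V (neighbours V E)"

text \<open>Ordered triples of vertices: every triangle of the graph occurs six times.\<close>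

definition triangles :: "'a set \<Rightarrow> 'a set set \<Rightarrow> (('a \<times> 'a) \<times> 'a) set" where
  "triangles V E = Sigma (darts V E) (\<lambda>(a, b). neighbours V E a \<inter> neighbours V E b)"

lemma mem_darts:
  assumes "simple_graph V E"
  shows "(a, b) \<in> darts V E \<longleftrightarrow> {a, b} \<in> E"
  using simple_graph_edgeD[OF assms] by (auto simp: darts_def neighbours_def)

lemma mem_triangles:
  assumes "simple_graph V E"
  shows "((a, b), c) \<in> triangles V E \<longleftrightarrow> {a, b} \<in> E \<and> {b, c} \<in> E \<and> {c, a} \<in> E"
  using simple_graph_edgeD[OF assms] mem_darts[OF assms]
  by (auto simp: triangles_def neighbours_def insert_commute)

lemma finite_neighbours: "simple_graph V E \<Longrightarrow> finite (neighbours V E u)"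
  using simple_graph_finite_vertices[of V E] by (simp add: neighbours_def)

lemma finite_darts: "simple_graph V E \<Longrightarrow> finite (darts V E)"
  by (simp add: darts_def simple_graph_finite_vertices finite_neighbours)

lemma card_darts:
  assumes "simple_graph V E"
  shows "card (darts V E) = 2 * card E"
proof -
  let ?g = "\<lambda>(a, b). {a, b}"
  have E: "?g ` darts V E = E"
  proof
    show "E \<subseteq> ?g ` darts V E"
    proof
      fix e assume "e \<in> E"
      moreover from this obtain a b where "e = {a, b}"
        using simple_graph_edgeE[OF assms] by metis
      ultimately show "e \<in> ?g ` darts V E"
        by (auto simp: mem_darts[OF assms] intro!: image_eqI[of _ _ "(a, b)"])
    qed
  qed (auto simp: mem_darts[OF assms])
  have "card {x \<in> darts V E. ?g x = e} = 2" if e: "e \<in> E" for e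
  proof -
    obtain a b where ab: "e = {a, b}" "a \<noteq> b"
      using simple_graph_edgeE[OF assms e] by metis
    then have "{x \<in> darts V E. ?g x = e} = {(a, b), (b, a)}"
      using e by (auto simp: mem_darts[OF assms] doubleton_eq_iff insert_commute)
    then show ?thesis using ab by simp
  qed
  then show ?thesis
    using card_eq_fibres[OF finite_darts[OF assms], of ?g 2] E by simp
qed

lemma card_vertices_of_triangles:
  assumes "simple_graph V E"
  shows "card (triangles V E) = card ((\<lambda>((a, b), c). {a, b, c}) ` triangles V E) * 6"
proof (rule card_eq_fibres)
  show "finite (triangles V E)"
    unfolding triangles_def using assms
    by (intro finite_SigmaI) (auto simp: finite_darts finite_neighbours)
next
  fix U assume "U \<in> (\<lambda>((a, b), c). {a, b, c}) ` triangles V E"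
  then obtain a b c where U: "U = {a, b, c}" and t: "{a, b} \<in> E" "{b, c} \<in> E" "{c, a} \<in> E"
    by (auto simp: mem_triangles[OF assms])
  have d: "a \<noteq> b" "b \<noteq> c" "c \<noteq> a"
    using t simple_graph_edgeD(3)[OF assms] by blast+
  let ?P = "{((a, b), c), ((a, c), b), ((b, a), c), ((b, c), a), ((c, a), b), ((c, b), a)}"
  have "{x \<in> triangles V E. (\<lambda>((a, b), c). {a, b, c}) x = U} = ?P"
  proof (intro subset_antisym subsetI)
    fix x assume "x \<in> {x \<in> triangles V E. (\<lambda>((a, b), c). {a, b, c}) x = U}"
    then obtain p q s where x: "x = ((p, q), s)" "{p, q} \<in> E" "{q, s} \<in> E" "{s, p} \<in> E" "{p, q, s} = U"
      by (auto simp: mem_triangles[OF assms])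
    then have "p \<noteq> q" "q \<noteq> s" "s \<noteq> p"
      using simple_graph_edgeD(3)[OF assms] by blast+
    moreover have "p \<in> {a, b, c}" "q \<in> {a, b, c}" "s \<in> {a, b, c}"
      using x(5) U by auto
    ultimately show "x \<in> ?P"
      unfolding x(1) by auto
  next
    fix x assume "x \<in> ?P"
    then show "x \<in> {x \<in> triangles V E. (\<lambda>((a, b), c). {a, b, c}) x = U}"
      using t by (auto simp: U mem_triangles[OF assms] insert_commute)
  qed
  then show "card {x \<in> triangles V E. (\<lambda>((a, b), c). {a, b, c}) x = U} = 6"
    using d by simp
qed

text \<open>Expresses the edges of a triangle through its vertex set alone, so that triangles with
  the same vertices are the same cycle.\<close>

lemma triangle_edges:
  assumes "distinct [a, b, c]"
  shows "{{a, b}, {b, c}, {c, a}} = {e. e \<subseteq> {a, b, c} \<and> card e = 2}"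
proof (intro subset_antisym subsetI)
  fix e assume "e \<in> {e. e \<subseteq> {a, b, c} \<and> card e = 2}"
  then obtain p q where "e = {p, q}" "p \<noteq> q" "p \<in> {a, b, c}" "q \<in> {a, b, c}"
    by (auto simp: card_2_iff)
  then show "e \<in> {{a, b}, {b, c}, {c, a}}"
    by (auto simp: insert_commute)
qed (use assms in auto)

text \<open>Any two edges of a triangle already cover its vertices, so a two-edge broken circuit
  determines its triangle.\<close>

lemma Union_triangle_Diff:
  assumes "m \<in> {{a, b}, {b, c}, {c, a}}" "distinct [a, b, c]"
  shows "\<Union>({{a, b}, {b, c}, {c, a}} - {m}) = {a, b, c}"
  using assms by (auto simp: doubleton_eq_iff)

text \<open>Taking unions is a bijection from the two-edge broken circuits to the vertex sets of
  triangles; its inverse deletes the largest edge of the triangle. Each vertex set comes from six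
  ordered triples.\<close>

lemma card_broken_circuits_2:
  assumes G: "simple_graph V E" and r: "linear_order_on E r"
  shows "card {B \<in> broken_circuits V E r. card B = 2} * 6 = card (triangles V E)"
proof -
  let ?D = "{B \<in> broken_circuits V E r. card B = 2}"
  have form: "\<exists>a b c m. distinct [a, b, c] \<and> {{a, b}, {b, c}, {c, a}} \<subseteq> E \<and>
      m \<in> {{a, b}, {b, c}, {c, a}} \<and> (\<forall>e\<in>{{a, b}, {b, c}, {c, a}}. (e, m) \<in> r) \<and>
      B = {{a, b}, {b, c}, {c, a}} - {m}" if "B \<in> ?D" for B
  proof -
    have "B \<in> broken_circuits V E r"
      using that by simp
    then obtain C m where C: "B = C - {m}" "is_cycle V E C" "m \<in> C"
        "\<forall>e\<in>C. (e, m) \<in> r" "card C = Suc (card B)"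
      by (rule broken_circuitE[OF G r])
    moreover have "card C = 3"
      using C(5) that by simp
    then obtain a b c where "C = {{a, b}, {b, c}, {c, a}}" "distinct [a, b, c]"
      using is_cycle_card_3E[OF C(2)] by metis
    ultimately show ?thesis
      using is_cycle_edges[OF C(2)] by blast
  qed
  have "bij_betw Union ?D ((\<lambda>((a, b), c). {a, b, c}) ` triangles V E)"
    unfolding bij_betw_def
  proof
    show "inj_on Union ?D"
    proof (rule inj_onI)
      fix B B' assume B: "B \<in> ?D" "B' \<in> ?D" "\<Union>B = \<Union>B'"
      obtain a b c m where 1: "distinct [a, b, c]" "m \<in> {{a, b}, {b, c}, {c, a}}"
        "\<forall>e\<in>{{a, b}, {b, c}, {c, a}}. (e, m) \<in> r" "B = {{a, b}, {b, c}, {c, a}} - {m}"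
        using form[OF B(1)] by auto
      obtain a' b' c' m' where 2: "distinct [a', b', c']" "m' \<in> {{a', b'}, {b', c'}, {c', a'}}"
        "\<forall>e\<in>{{a', b'}, {b', c'}, {c', a'}}. (e, m') \<in> r" "B' = {{a', b'}, {b', c'}, {c', a'}} - {m'}"
        using form[OF B(2)] by auto
      have "{a, b, c} = {a', b', c'}"
        using B(3) Union_triangle_Diff[OF 1(2,1)] Union_triangle_Diff[OF 2(2,1)] 1(4) 2(4) by simp
      then have C: "{{a, b}, {b, c}, {c, a}} = {{a', b'}, {b', c'}, {c', a'}}"
        unfolding triangle_edges[OF 1(1)] triangle_edges[OF 2(1)] by simp
      \<comment> \<open>Both edges are the maximum of the same triangle.\<close>
      then have "m = m'"
        using 1(2,3) 2(2,3) order_antisym[OF G r, of m m'] by metis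
      then show "B = B'"
        unfolding 1(4) 2(4) C by simp
    qed
    show "Union ` ?D = (\<lambda>((a, b), c). {a, b, c}) ` triangles V E"
    proof (intro subset_antisym subsetI)
      fix U assume "U \<in> Union ` ?D"
      then obtain B where B: "B \<in> ?D" "U = \<Union>B"
        by blast
      obtain a b c m where 1: "distinct [a, b, c]" "{{a, b}, {b, c}, {c, a}} \<subseteq> E"
        "m \<in> {{a, b}, {b, c}, {c, a}}" "B = {{a, b}, {b, c}, {c, a}} - {m}"
        using form[OF B(1)] by auto
      have "U = {a, b, c}"
        unfolding B(2) 1(4) by (rule Union_triangle_Diff[OF 1(3,1)])
      moreover have "((a, b), c) \<in> triangles V E"
        using 1(2) by (simp add: mem_triangles[OF G])
      ultimately show "U \<in> (\<lambda>((a, b), c). {a, b, c}) ` triangles V E"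
        by (auto intro!: image_eqI[of _ _ "((a, b), c)"])
    next
      fix U assume "U \<in> (\<lambda>((a, b), c). {a, b, c}) ` triangles V E"
      then obtain a b c where U: "U = {a, b, c}" and t: "{a, b} \<in> E" "{b, c} \<in> E" "{c, a} \<in> E"
        by (auto simp: mem_triangles[OF G])
      have d: "distinct [a, b, c]"
        using t simple_graph_edgeD(3)[OF G] by auto
      define C where "C = {{a, b}, {b, c}, {c, a}}"
      have cyc: "is_cycle V E C"
        unfolding C_def by (rule is_cycle_triangle[OF G t])
      obtain m where m: "m \<in> C" "\<forall>e\<in>C. (e, m) \<in> r"
        using cycle_has_max[OF G r cyc] by blast
      have "card C = 3"
        using d by (auto simp: C_def card_insert_if doubleton_eq_iff)
      then have "card (C - {m}) = 2"
        using m by simp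
      moreover have "C - {m} \<in> broken_circuits V E r"
        using cyc m by (auto simp: broken_circuits_def)
      moreover have "U = \<Union>(C - {m})"
        using Union_triangle_Diff[OF m(1)[unfolded C_def] d] by (simp add: C_def U)
      ultimately show "U \<in> Union ` ?D"
        by blast
    qed
  qed
  then show ?thesis
    using card_vertices_of_triangles[OF G] bij_betw_same_card by simp
qed

section \<open>Counts in a strongly regular graph\<close>

context
  fixes V :: "'a set" and E :: "'a set set" and v k l m :: nat
  assumes srg: "strongly_regular_graph V E v k l m"
begin

lemma srg_simple: "simple_graph V E" and srg_card: "card V = v"
  and srg_degree: "u \<in> V \<Longrightarrow> card (neighbours V E u) = k"
  and srg_common: "{u, w} \<in> E \<Longrightarrow> card (neighbours V E u \<inter> neighbours V E w) = l"
  using srg simple_graph_edgeD[of V E u w] by (auto simp: strongly_regular_graph_def)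

lemma srg_card_darts: "card (darts V E) = v * k"
  unfolding darts_def using srg_degree srg_card
  by (subst card_SigmaI) (auto simp: simple_graph_finite_vertices[OF srg_simple] finite_neighbours[OF srg_simple])

text \<open>Each of the \<open>v * k\<close> darts is completed to a triangle by exactly the
  \<open>l\<close> common neighbours of its ends.\<close>

lemma srg_card_triangles: "card (triangles V E) = v * k * l"
proof -
  have "card (triangles V E) = (\<Sum>(a, b)\<in>darts V E. card (neighbours V E a \<inter> neighbours V E b))"
    unfolding triangles_def
    by (subst card_SigmaI) (auto simp: finite_darts[OF srg_simple] finite_neighbours[OF srg_simple] intro!: sum.cong)
  also have "\<dots> = (\<Sum>(a, b)\<in>darts V E. l)"
    by (intro sum.cong refl) (auto simp: mem_darts[OF srg_simple] srg_common)
  finally show ?thesis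
    by (simp add: srg_card_darts)
qed

end

section \<open>Prime ideals of polynomial rings\<close>

lemma poly_mapping_eq_sum_single:
  "p = (\<Sum>t\<in>Poly_Mapping.keys p. Poly_Mapping.single t (Poly_Mapping.lookup p t))"
proof (rule poly_mapping_eqI)
  fix t
  show "Poly_Mapping.lookup p t = Poly_Mapping.lookup
          (\<Sum>t\<in>Poly_Mapping.keys p. Poly_Mapping.single t (Poly_Mapping.lookup p t)) t"
    by (auto simp: lookup_sum lookup_single when_def sum.delta' in_keys_iff)
qed

lemma keys_sum_subset: "Poly_Mapping.keys (\<Sum>i\<in>I. f i) \<subseteq> (\<Union>i\<in>I. Poly_Mapping.keys (f i))"
proof (induction I rule: infinite_finite_induct)
  case (insert x I)
  then show ?case
    using Poly_Mapping.keys_add[of "f x" "\<Sum>i\<in>I. f i"] by auto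
qed auto

lemma keys_mult_exponents:
  fixes p q :: "('e, 'k::field) mpoly"
  assumes "u \<in> Poly_Mapping.keys (p * q)"
  obtains s t where "s \<in> Poly_Mapping.keys p" "t \<in> Poly_Mapping.keys q" "u = s + t"
  using Poly_Mapping.keys_mult[of p q] assms by blast

text \<open>Exponents are natural numbers, so nothing cancels.\<close>

lemma keys_add_nat:
  "Poly_Mapping.keys (s + t :: 'e \<Rightarrow>\<^sub>0 nat) = Poly_Mapping.keys s \<union> Poly_Mapping.keys t"
  by (auto simp: in_keys_iff lookup_add)

lemma keys_uminus_mpoly: "Poly_Mapping.keys (- p :: ('e, 'k::field) mpoly) = Poly_Mapping.keys p"
  by (auto simp: in_keys_iff)

lemma mpoly_ring_simps:
  "carrier (mpoly_ring X) = {p. \<forall>t \<in> Poly_Mapping.keys p. Poly_Mapping.keys t \<subseteq> X}"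
  "mult (mpoly_ring X) = (*)" "one (mpoly_ring X) = 1"
  "zero (mpoly_ring X) = 0" "add (mpoly_ring X) = (+)"
  by (simp_all add: mpoly_ring_def)

lemma mpoly_carrier_mult:
  "p \<in> carrier (mpoly_ring X) \<Longrightarrow> q \<in> carrier (mpoly_ring X) \<Longrightarrow> p * q \<in> carrier (mpoly_ring X)"
  by (simp add: mpoly_ring_simps) (metis (no_types, lifting) keys_mult_exponents keys_add_nat Un_least)

lemma mpoly_carrier_add:
  "p \<in> carrier (mpoly_ring X) \<Longrightarrow> q \<in> carrier (mpoly_ring X) \<Longrightarrow> p + q \<in> carrier (mpoly_ring X)"
  using Poly_Mapping.keys_add[of p q] by (auto simp: mpoly_ring_simps)

lemma mpoly_carrier_uminus:
  "p \<in> carrier (mpoly_ring X) \<Longrightarrow> - p \<in> carrier (mpoly_ring X)"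
  by (auto simp: mpoly_ring_simps keys_uminus_mpoly)

lemma mpoly_carrier_const: "Poly_Mapping.single 0 c \<in> carrier (mpoly_ring X)"
  by (auto simp: mpoly_ring_simps)

lemma mpoly_carrier_0: "0 \<in> carrier (mpoly_ring X)"
  by (auto simp: mpoly_ring_simps)

lemma mpoly_carrier_1: "1 \<in> carrier (mpoly_ring X)"
  by (auto simp: mpoly_ring_simps)

lemma mpoly_carrier_var: "e \<in> X \<Longrightarrow> mpoly_var e \<in> carrier (mpoly_ring X)"
  by (auto simp: mpoly_ring_simps mpoly_var_def)

lemma mpoly_carrier_power:
  "p \<in> carrier (mpoly_ring X) \<Longrightarrow> p ^ n \<in> carrier (mpoly_ring X)"
  by (induction n) (auto intro: mpoly_carrier_mult mpoly_carrier_1)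

lemma mpoly_carrier_prod:
  "(\<And>i. i \<in> I \<Longrightarrow> f i \<in> carrier (mpoly_ring X)) \<Longrightarrow> prod f I \<in> carrier (mpoly_ring X)"
  by (induction I rule: infinite_finite_induct) (auto intro: mpoly_carrier_mult mpoly_carrier_1)

lemma mpoly_carrier_sum:
  "(\<And>i. i \<in> I \<Longrightarrow> f i \<in> carrier (mpoly_ring X)) \<Longrightarrow> sum f I \<in> carrier (mpoly_ring X)"
  by (induction I rule: infinite_finite_induct) (auto intro: mpoly_carrier_add mpoly_carrier_0)

lemmas mpoly_carrier = mpoly_carrier_mult mpoly_carrier_add mpoly_carrier_uminus
  mpoly_carrier_const mpoly_carrier_0 mpoly_carrier_1 mpoly_carrier_var
  mpoly_carrier_power mpoly_carrier_prod mpoly_carrier_sum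

lemma cring_mpoly_ring: "cring (mpoly_ring X :: ('e, 'k::field) mpoly ring)"
proof (rule cringI)
  show "abelian_group (mpoly_ring X :: ('e, 'k) mpoly ring)"
  proof (rule abelian_groupI)
    fix p :: "('e, 'k) mpoly"
    assume "p \<in> carrier (mpoly_ring X)"
    then show "\<exists>q\<in>carrier (mpoly_ring X). q \<oplus>\<^bsub>mpoly_ring X\<^esub> p = \<zero>\<^bsub>mpoly_ring X\<^esub>"
      by (intro bexI[of _ "- p"]) (auto simp: mpoly_ring_simps(2-) intro: mpoly_carrier)
  qed (auto simp: mpoly_ring_simps(2-) algebra_simps intro: mpoly_carrier)
  show "comm_monoid (mpoly_ring X :: ('e, 'k) mpoly ring)"
    by (rule comm_monoidI) (auto simp: mpoly_ring_simps(2-) algebra_simps intro: mpoly_carrier)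
qed (auto simp: mpoly_ring_simps(2-) algebra_simps)

section \<open>Closure properties of prime ideals\<close>

context
  fixes Q :: "('e, 'k::field) mpoly set" and X :: "'e set"
  assumes Q: "primeideal Q (mpoly_ring X)"
begin

lemma mpoly_primeideal_subset: "Q \<subseteq> carrier (mpoly_ring X)"
  using Q additive_subgroup.a_subset[OF ideal.axioms(1)] primeideal.axioms(1) by blast

lemma mpoly_primeideal_zero: "0 \<in> Q"
  using additive_subgroup.zero_closed[OF ideal.axioms(1)[OF primeideal.axioms(1)[OF Q]]]
  by (simp add: mpoly_ring_simps(2-))

lemma mpoly_primeideal_add: "p \<in> Q \<Longrightarrow> q \<in> Q \<Longrightarrow> p + q \<in> Q"
  using additive_subgroup.a_closed[OF ideal.axioms(1)[OF primeideal.axioms(1)[OF Q]]]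
  by (simp add: mpoly_ring_simps(2-))

lemma mpoly_primeideal_mult: "p \<in> Q \<Longrightarrow> q \<in> carrier (mpoly_ring X) \<Longrightarrow> q * p \<in> Q"
  using ideal.I_l_closed[OF primeideal.axioms(1)[OF Q]]
  by (simp add: mpoly_ring_simps(2-))

lemma mpoly_primeideal_diff: "p \<in> Q \<Longrightarrow> q \<in> Q \<Longrightarrow> p - q \<in> Q"
  using mpoly_primeideal_add[of p "(- 1) * q"] mpoly_primeideal_mult[of q "- 1"]
    mpoly_carrier_uminus[OF mpoly_carrier_1, where ?'a = 'e and ?'b = 'k] by simp

lemma mpoly_primeideal_sum: "(\<And>i. i \<in> I \<Longrightarrow> f i \<in> Q) \<Longrightarrow> sum f I \<in> Q"
  by (induction I rule: infinite_finite_induct)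
    (auto intro: mpoly_primeideal_add mpoly_primeideal_zero)

lemma mpoly_primeideal_prime:
  "p \<in> carrier (mpoly_ring X) \<Longrightarrow> q \<in> carrier (mpoly_ring X) \<Longrightarrow> p * q \<in> Q \<Longrightarrow> p \<in> Q \<or> q \<in> Q"
  using primeideal.I_prime[OF Q] by (simp add: mpoly_ring_simps(2-))

lemma mpoly_primeideal_one: "1 \<notin> Q"
proof
  assume "1 \<in> Q"
  then have "carrier (mpoly_ring X) \<subseteq> Q"
    using mpoly_primeideal_mult[of 1] by auto
  then show False
    using primeideal.I_notcarr[OF Q] mpoly_primeideal_subset by auto
qed

text \<open>Nonzero constants are units.\<close>

lemma mpoly_primeideal_const: "c \<noteq> 0 \<Longrightarrow> Poly_Mapping.single 0 c \<notin> Q"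
  using mpoly_primeideal_mult[OF _ mpoly_carrier_const, of "Poly_Mapping.single 0 c" "1 / c"]
    mpoly_primeideal_one by (auto simp: mult_single)

lemma mpoly_primeideal_power: "p \<in> carrier (mpoly_ring X) \<Longrightarrow> p ^ n \<in> Q \<Longrightarrow> p \<in> Q"
proof (induction n)
  case (Suc n)
  then show ?case
    using mpoly_primeideal_prime[of p "p ^ n"] mpoly_carrier_power[of p X n] by auto
qed (use mpoly_primeideal_one in simp)

lemma mpoly_primeideal_prod:
  "finite I \<Longrightarrow> (\<And>i. i \<in> I \<Longrightarrow> f i \<in> carrier (mpoly_ring X)) \<Longrightarrow> prod f I \<in> Q \<Longrightarrow>
     \<exists>i\<in>I. f i \<in> Q"
proof (induction I rule: finite_induct)
  case empty
  then show ?case using mpoly_primeideal_one by simp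
next
  case (insert x I)
  then show ?case
    using mpoly_primeideal_prime[of "f x" "prod f I"] mpoly_carrier_prod[of I f X] by auto
qed

end

text \<open>
  Dividing out the lowest power of \<open>f j\<close> and passing from \<open>Q j\<close> to \<open>Q (Suc j)\<close> kills all but the
  terms in which that power was attained; this peels off one variable at a time.
\<close>

lemma prime_chain_algebraically_independent:
  fixes Q :: "nat \<Rightarrow> ('e, 'k::field) mpoly set" and a :: "nat \<Rightarrow> nat"
  assumes prime: "\<And>i. i \<le> n \<Longrightarrow> primeideal (Q i) (mpoly_ring X)"
    and mono: "\<And>i. i < n \<Longrightarrow> Q i \<subseteq> Q (Suc i)"
    and f: "\<And>i. i < n \<Longrightarrow> f i \<in> Q (Suc i) - Q i"
    and "j \<le> n" "finite A" "A \<noteq> {}" "\<And>a. a \<in> A \<Longrightarrow> c a \<noteq> 0"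
    and "\<And>a b. a \<in> A \<Longrightarrow> b \<in> A \<Longrightarrow> (\<And>i. j \<le> i \<Longrightarrow> i < n \<Longrightarrow> a i = b i) \<Longrightarrow> a = b"
  shows "(\<Sum>a\<in>A. Poly_Mapping.single 0 (c a) * (\<Prod>i=j..<n. f i ^ a i)) \<notin> Q j"
  using assms(4-)
proof (induction j arbitrary: A rule: inc_induct)
  case base
  \<comment> \<open>At \<open>j = n\<close> no coordinate is left to tell elements of
    \<open>A\<close> apart, and the product is empty, so the sum is a nonzero constant.\<close>
  then obtain a where "A = {a}"
    by (metis all_not_in_conv is_singletonI' is_singleton_def leD)
  then show ?case
    using mpoly_primeideal_const[OF prime] base by simp
next
  case (step j)
  note P = prime[of j] and P' = prime[of "Suc j"]
  have fc: "f i \<in> carrier (mpoly_ring X)" if "i < n" for i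
    using mpoly_primeideal_subset[OF prime[of "Suc i"]] f[OF that] that by auto
  define m where "m = Min ((\<lambda>a. a j) ` A)"
  have m: "m \<le> a j" if "a \<in> A" for a
    using that step.prems by (auto simp: m_def)
  define A0 where "A0 = {a \<in> A. a j = m}"
  have "m \<in> (\<lambda>a. a j) ` A"
    unfolding m_def using step.prems by (intro Min_in) auto
  then have "A0 \<noteq> {}"
    by (auto simp: A0_def)
  define g where "g a = Poly_Mapping.single 0 (c a) * (\<Prod>i=Suc j..<n. f i ^ a i)" for a
  have gc: "g a \<in> carrier (mpoly_ring X)" for a
    unfolding g_def using fc by (intro mpoly_carrier) auto
  \<comment> \<open>Exponents in \<open>A0\<close> agree at \<open>j\<close>, so the later
    coordinates still distinguish them.\<close>
  have "(\<Sum>a\<in>A0. g a) \<notin> Q (Suc j)"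
    unfolding g_def
  proof (rule step.IH)
    fix a b
    assume "a \<in> A0" "b \<in> A0" and eq: "\<And>i. Suc j \<le> i \<Longrightarrow> i < n \<Longrightarrow> a i = b i"
    then have "a i = b i" if "j \<le> i" "i < n" for i
      using that by (cases "i = j") (auto simp: A0_def)
    then show "a = b"
      using \<open>a \<in> A0\<close> \<open>b \<in> A0\<close> step.prems(4) by (auto simp: A0_def)
  qed (use \<open>A0 \<noteq> {}\<close> step.prems in \<open>auto simp: A0_def\<close>)
  show ?case
  proof
    assume "(\<Sum>a\<in>A. Poly_Mapping.single 0 (c a) * (\<Prod>i=j..<n. f i ^ a i)) \<in> Q j"
    also have "(\<Sum>a\<in>A. Poly_Mapping.single 0 (c a) * (\<Prod>i=j..<n. f i ^ a i)) =
        (\<Sum>a\<in>A. f j ^ m * (f j ^ (a j - m) * g a))"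
    proof (rule sum.cong[OF refl])
      fix a assume "a \<in> A"
      then have "f j ^ a j = f j ^ m * f j ^ (a j - m)"
        using m by (simp flip: power_add)
      then show "Poly_Mapping.single 0 (c a) * (\<Prod>i=j..<n. f i ^ a i) =
          f j ^ m * (f j ^ (a j - m) * g a)"
        using step.hyps by (simp add: prod.atLeast_Suc_lessThan g_def mult_ac)
    qed
    also have "\<dots> = f j ^ m * (\<Sum>a\<in>A. f j ^ (a j - m) * g a)"
      by (simp add: sum_distrib_left)
    finally have "f j ^ m * (\<Sum>a\<in>A. f j ^ (a j - m) * g a) \<in> Q j" .
    \<comment> \<open>Since \<open>f j\<close> lies outside the prime \<open>Q j\<close>, its power
      can be cancelled.\<close>
    moreover have "f j ^ m \<notin> Q j"
      using mpoly_primeideal_power[OF P fc] f step.hyps by auto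
    ultimately have "(\<Sum>a\<in>A. f j ^ (a j - m) * g a) \<in> Q j"
      using mpoly_primeideal_prime[OF P, of "f j ^ m"] step.hyps fc gc
      by (meson less_imp_le_nat mpoly_carrier_mult mpoly_carrier_power mpoly_carrier_sum)
    then have "(\<Sum>a\<in>A. f j ^ (a j - m) * g a) \<in> Q (Suc j)"
      using mono step.hyps by auto
    moreover have "(\<Sum>a\<in>A. f j ^ (a j - m) * g a) =
        (\<Sum>a\<in>A0. g a) + (\<Sum>a\<in>A - A0. f j ^ (a j - m) * g a)"
      using step.prems(1) by (subst sum.subset_diff[of A0 A]) (auto simp: A0_def add.commute)
    \<comment> \<open>Each of these terms retains a factor \<open>f j\<close>, which lies in
      \<open>Q (Suc j)\<close>.\<close>
    moreover have "(\<Sum>a\<in>A - A0. f j ^ (a j - m) * g a) \<in> Q (Suc j)"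
    proof (rule mpoly_primeideal_sum[OF P'])
      fix a assume "a \<in> A - A0"
      then have "m < a j" using m[of a] by (auto simp: A0_def)
      then obtain d where d: "a j - m = Suc d"
        using zero_less_diff gr0_conv_Suc by blast
      have "(f j ^ d * g a) * f j \<in> Q (Suc j)"
        using f step.hyps fc gc
        by (intro mpoly_primeideal_mult[OF P']) (auto intro!: mpoly_carrier)
      then show "f j ^ (a j - m) * g a \<in> Q (Suc j)"
        by (simp add: d mult_ac)
    qed (use step.hyps in auto)
    ultimately have "(\<Sum>a\<in>A0. g a) \<in> Q (Suc j)"
      using mpoly_primeideal_diff[OF P', of "sum g A0 + (\<Sum>a\<in>A - A0. f j ^ (a j - m) * g a)"
          "\<Sum>a\<in>A - A0. f j ^ (a j - m) * g a"] step.hyps by simp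
    with \<open>(\<Sum>a\<in>A0. g a) \<notin> Q (Suc j)\<close> show False by simp
  qed
qed

text \<open>Each exponent is bounded separately, instead of the total degree, so that the admissible
  monomials are functions into an interval and easy to count.\<close>

definition supported_below :: "'e set \<Rightarrow> nat \<Rightarrow> ('e, 'k::field) mpoly \<Rightarrow> bool" where
  "supported_below F d p \<longleftrightarrow>
     (\<forall>t\<in>Poly_Mapping.keys p. Poly_Mapping.keys t \<subseteq> F \<and> (\<forall>e. Poly_Mapping.lookup t e \<le> d))"

lemma supported_below_one: "supported_below F 0 1"
  by (auto simp: supported_below_def)

lemma supported_below_mult:
  assumes "supported_below F a p" "supported_below F b q"
  shows "supported_below F (a + b) (p * q)"
  unfolding supported_below_def
proof
  fix u assume "u \<in> Poly_Mapping.keys (p * q)"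
  then obtain s t where "s \<in> Poly_Mapping.keys p" "t \<in> Poly_Mapping.keys q" "u = s + t"
    by (rule keys_mult_exponents)
  with assms show "Poly_Mapping.keys u \<subseteq> F \<and> (\<forall>e. Poly_Mapping.lookup u e \<le> a + b)"
    by (auto simp: supported_below_def keys_add_nat lookup_add intro!: add_mono)
qed

lemma supported_below_power:
  "supported_below F a p \<Longrightarrow> supported_below F (n * a) (p ^ n)"
  by (induction n) (auto simp: supported_below_one dest: supported_below_mult)

lemma supported_below_prod:
  "(\<And>i. i \<in> I \<Longrightarrow> supported_below F (d i) (f i)) \<Longrightarrow> supported_below F (sum d I) (prod f I)"
  by (induction I rule: infinite_finite_induct)
    (auto simp: supported_below_one intro: supported_below_mult)

lemma supported_below_mono: "supported_below F a p \<Longrightarrow> a \<le> b \<Longrightarrow> supported_below F b p"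
  unfolding supported_below_def by (meson le_trans)

lemma supported_below_exists:
  assumes "\<forall>t\<in>Poly_Mapping.keys p. Poly_Mapping.keys t \<subseteq> F"
  shows "\<exists>d. supported_below F d p"
proof -
  define d where
    "d = (\<Sum>t\<in>Poly_Mapping.keys p. \<Sum>e\<in>Poly_Mapping.keys t. Poly_Mapping.lookup t e)"
  have "Poly_Mapping.lookup t e \<le> d" if t: "t \<in> Poly_Mapping.keys p" for t e
  proof (cases "e \<in> Poly_Mapping.keys t")
    case True
    then have "Poly_Mapping.lookup t e \<le> (\<Sum>e\<in>Poly_Mapping.keys t. Poly_Mapping.lookup t e)"
      by (intro member_le_sum) auto
    also have "\<dots> \<le> d"
      unfolding d_def using t by (intro member_le_sum) auto
    finally show ?thesis .
  qed (auto simp: in_keys_iff)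
  then show ?thesis
    using assms by (auto simp: supported_below_def)
qed

text \<open>A monomial of this kind is determined by its exponents on \<open>F\<close>, each of
  which has \<open>d + 1\<close> possible values.\<close>

lemma card_bounded_monomials:
  fixes d :: nat
  assumes "finite F"
  defines "M \<equiv> {t :: 'e \<Rightarrow>\<^sub>0 nat. Poly_Mapping.keys t \<subseteq> F \<and> (\<forall>e. Poly_Mapping.lookup t e \<le> d)}"
  shows "finite M" "card M \<le> (d + 1) ^ card F"
proof -
  let ?res = "\<lambda>t. restrict (Poly_Mapping.lookup t) F"
  have inj: "inj_on ?res M"
  proof (rule inj_onI)
    fix s t
    assume st: "s \<in> M" "t \<in> M" and eq: "?res s = ?res t"
    show "s = t"
    proof (rule poly_mapping_eqI)
      fix e
      show "Poly_Mapping.lookup s e = Poly_Mapping.lookup t e"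
      proof (cases "e \<in> F")
        case True
        then show ?thesis using fun_cong[OF eq, of e] by simp
      next
        case False
        then have "e \<notin> Poly_Mapping.keys s" "e \<notin> Poly_Mapping.keys t"
          using st by (auto simp: M_def)
        then show ?thesis by (simp add: in_keys_iff)
      qed
    qed
  qed
  have sub: "?res ` M \<subseteq> F \<rightarrow>\<^sub>E {..d}"
    by (auto simp: M_def)
  have fin: "finite (F \<rightarrow>\<^sub>E {..d})"
    using assms by (intro finite_PiE) auto
  show "finite M"
    using finite_imageD[OF finite_subset[OF sub fin] inj] .
  have "card M \<le> card (F \<rightarrow>\<^sub>E {..d})"
    using card_inj_on_le[OF inj sub fin] .
  then show "card M \<le> (d + 1) ^ card F"
    using assms by (simp add: card_PiE)
qed

text \<open>Scalars act as constant polynomials; this allows independent sets to be compared with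
  spanning sets.\<close>

lemma vector_space_mpoly:
  "vector_space (\<lambda>c (p :: ('e, 'k::field) mpoly). Poly_Mapping.single 0 c * p)"
  by unfold_locales
    (auto simp: algebra_simps single_add mult_single simp flip: mult.assoc)

text \<open>
  Counting: the \<open>N ^ n\<close> products of powers of the \<open>f i\<close> with exponents below \<open>N\<close> are independent
  elements of a space of dimension at most \<open>(n * D * N + 1) ^ card F\<close>, for every \<open>N\<close>.
\<close>

lemma prime_chain_length_le:
  fixes Q :: "nat \<Rightarrow> ('e, 'k::field) mpoly set"
  assumes prime: "\<And>i. i \<le> n \<Longrightarrow> primeideal (Q i) (mpoly_ring X)"
    and mono: "\<And>i. i < n \<Longrightarrow> Q i \<subseteq> Q (Suc i)"
    and f: "\<And>i. i < n \<Longrightarrow> f i \<in> Q (Suc i) - Q i"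
    and F: "finite F" "\<And>i. i < n \<Longrightarrow> \<forall>t\<in>Poly_Mapping.keys (f i). Poly_Mapping.keys t \<subseteq> F"
  shows "n \<le> card F"
proof (rule ccontr)
  assume "\<not> n \<le> card F"
  interpret vs: vector_space "\<lambda>c (p :: ('e, 'k) mpoly). Poly_Mapping.single 0 c * p"
    by (rule vector_space_mpoly)
  obtain d where d: "\<And>i. i < n \<Longrightarrow> supported_below F (d i) (f i)"
    using supported_below_exists[OF F(2)] by metis
  define D where "D = (\<Sum>i<n. d i)"
  have D: "supported_below F D (f i)" if "i < n" for i
    using supported_below_mono[OF d[OF that]] that by (simp add: D_def member_le_sum)
  define M where "M = n * D + 1"
  \<comment> \<open>Chosen larger than \<open>M ^ card F\<close>: as
    \<open>n * D * N + 1 \<le> M * N\<close>, the space has dimension at most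
    \<open>(M * N) ^ card F\<close>, which is less than \<open>N ^ Suc (card F)\<close>.\<close>
  define N where "N = M ^ card F + 1"
  define g where "g a = (\<Prod>i=0..<n. f i ^ a i)" for a :: "nat \<Rightarrow> nat"
  define A where "A = {0..<n} \<rightarrow>\<^sub>E {..<N}"
  have indep: "(\<Sum>a\<in>B. Poly_Mapping.single 0 (c a) * g a) \<noteq> 0"
    if B: "B \<subseteq> A" "finite B" "B \<noteq> {}" "\<And>a. a \<in> B \<Longrightarrow> c a \<noteq> 0" for B c
  proof -
    have "(\<Sum>a\<in>B. Poly_Mapping.single 0 (c a) * g a) \<notin> Q 0"
      unfolding g_def
    proof (rule prime_chain_algebraically_independent[where Q = Q and f = f and X = X and n = n])
      fix a b
      assume ab: "a \<in> B" "b \<in> B" "\<And>i. 0 \<le> i \<Longrightarrow> i < n \<Longrightarrow> a i = b i"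
      then show "a = b"
        using B(1) by (intro PiE_ext[of a "{0..<n}" "\<lambda>_. {..<N}" b]) (auto simp: A_def)
    qed (use B prime mono f in auto)
    then show ?thesis
      using mpoly_primeideal_zero[OF prime[of 0]] by (intro notI) simp
  qed
  \<comment> \<open>Equal products for different exponents would be a relation with coefficients 1
    and -1.\<close>
  have inj: "inj_on g A"
  proof (rule inj_onI, rule ccontr)
    fix a b
    assume ab: "a \<in> A" "b \<in> A" "g a = g b" "a \<noteq> b"
    have "(\<Sum>x\<in>{a, b}. Poly_Mapping.single 0 (if x = a then 1 else - 1) * g x) \<noteq> 0"
      using ab by (intro indep) auto
    then show False
      using ab by (simp add: single_uminus)
  qed
  have "\<not> vs.dependent (g ` A)"
    unfolding vs.dependent_explicit
  proof (rule notI, elim exE conjE bexE)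
    fix S u v
    assume S: "finite S" "S \<subseteq> g ` A" "v \<in> S" "u v \<noteq> 0"
      and zero: "(\<Sum>v\<in>S. Poly_Mapping.single 0 (u v) * v) = 0"
    \<comment> \<open>The relation is pulled back to exponents, and terms with coefficient zero are
      dropped, as \<open>indep\<close> requires.\<close>
    define B where "B = {a \<in> A. g a \<in> S \<and> u (g a) \<noteq> 0}"
    have B: "B \<subseteq> A" "inj_on g B"
      using inj by (auto simp: B_def intro: inj_on_subset)
    have im: "g ` B = {v \<in> S. u v \<noteq> 0}"
      using S by (auto simp: B_def)
    have "(\<Sum>a\<in>B. Poly_Mapping.single 0 (u (g a)) * g a) = (\<Sum>v\<in>g ` B. Poly_Mapping.single 0 (u v) * v)"
      by (simp add: sum.reindex[OF B(2)])
    also have "\<dots> = (\<Sum>v\<in>S. Poly_Mapping.single 0 (u v) * v)"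
      unfolding im using S by (intro sum.mono_neutral_left) auto
    finally have "(\<Sum>a\<in>B. Poly_Mapping.single 0 (u (g a)) * g a) = 0"
      using zero by simp
    moreover have "finite B"
      using finite_imageD[OF _ B(2)] im S by simp
    moreover have "B \<noteq> {}"
      using im S by auto
    moreover have "\<And>a. a \<in> B \<Longrightarrow> u (g a) \<noteq> 0"
      by (simp add: B_def)
    ultimately show False
      using indep[OF B(1), of "\<lambda>a. u (g a)"] by blast
  qed
  moreover define T where "T = {t. Poly_Mapping.keys t \<subseteq> F \<and> (\<forall>e. Poly_Mapping.lookup t e \<le> n * D * N)}"
  have T: "finite T" "card T \<le> (n * D * N + 1) ^ card F"
    unfolding T_def using card_bounded_monomials[OF F(1)] by auto
  have "g ` A \<subseteq> vs.span ((\<lambda>t. Poly_Mapping.single t 1) ` T)"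
  proof
    fix p assume "p \<in> g ` A"
    then obtain a where a: "a \<in> A" "p = g a" by auto
    \<comment> \<open>The factor with index \<open>i\<close> contributes at most
      \<open>a i * D\<close> to each exponent, and \<open>a i < N\<close>.\<close>
    have "supported_below F (\<Sum>i=0..<n. a i * D) p"
      unfolding a g_def using D
      by (intro supported_below_prod supported_below_power) auto
    moreover have "(\<Sum>i=0..<n. a i * D) \<le> (\<Sum>i=0..<n. N * D)"
      using a by (intro sum_mono mult_right_mono) (auto simp: A_def PiE_iff less_imp_le)
    ultimately have "supported_below F (n * D * N) p"
      using supported_below_mono by (fastforce simp: mult_ac)
    then have keys: "Poly_Mapping.keys p \<subseteq> T"
      by (auto simp: supported_below_def T_def)
    have "(\<Sum>t\<in>Poly_Mapping.keys p. Poly_Mapping.single 0 (Poly_Mapping.lookup p t) * Poly_Mapping.single t 1)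
        \<in> vs.span ((\<lambda>t. Poly_Mapping.single t 1) ` T)"
      using keys by (intro vs.span_sum vs.span_scale vs.span_base) auto
    then show "p \<in> vs.span ((\<lambda>t. Poly_Mapping.single t 1) ` T)"
      by (simp add: mult_single flip: poly_mapping_eq_sum_single)
  qed
  ultimately have "card (g ` A) \<le> card ((\<lambda>t. Poly_Mapping.single t (1::'k)) ` T)"
    using vs.independent_span_bound T by blast
  also have "\<dots> \<le> card T"
    using T by (intro card_image_le)
  finally have "card A \<le> (n * D * N + 1) ^ card F"
    using T by (simp add: card_image[OF inj])
  then have "N ^ n \<le> (n * D * N + 1) ^ card F"
    by (simp add: A_def card_PiE)
  also have "\<dots> \<le> (M * N) ^ card F"
    by (intro power_mono) (auto simp: M_def N_def algebra_simps)
  also have "\<dots> < N * N ^ card F"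
    unfolding power_mult_distrib by (intro mult_strict_right_mono) (auto simp: N_def)
  also have "\<dots> = N ^ Suc (card F)"
    by simp
  also have "\<dots> \<le> N ^ n"
    using \<open>\<not> n \<le> card F\<close> by (intro power_increasing) (auto simp: N_def)
  finally show False by simp
qed

text \<open>Such a monomial is a multiple of the variable \<open>e\<close>.\<close>

lemma mpoly_primeideal_monomial:
  fixes Q :: "('e, 'k::field) mpoly set"
  assumes Q: "primeideal Q (mpoly_ring X)"
    and e: "mpoly_var e \<in> Q" "e \<in> Poly_Mapping.keys t" and t: "Poly_Mapping.keys t \<subseteq> X"
  shows "Poly_Mapping.single t c \<in> Q"
proof -
  define s where "s = t - Poly_Mapping.single e 1"
  have "t = s + Poly_Mapping.single e 1"
    using e(2) by (intro poly_mapping_eqI)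
      (auto simp: s_def lookup_add lookup_minus lookup_single when_def in_keys_iff)
  then have eq: "Poly_Mapping.single t c = Poly_Mapping.single s c * mpoly_var e"
    by (simp add: mpoly_var_def mult_single)
  have "Poly_Mapping.keys s \<subseteq> X"
    using t \<open>t = s + _\<close> by (metis Un_subset_iff keys_add_nat)
  then have "Poly_Mapping.single s c \<in> carrier (mpoly_ring X)"
    by (simp add: mpoly_ring_simps)
  then show ?thesis
    unfolding eq by (rule mpoly_primeideal_mult[OF Q e(1)])
qed

text \<open>Every term containing a variable from \<open>Q 0\<close> lies in \<open>Q 0\<close>,
  hence in all members of the chain. Cutting such terms from the witnesses of strictness leaves them
  witnesses and makes them polynomials in the variables outside \<open>Q 0\<close> only.\<close>

lemma mpoly_ring_prime_chain_length:
  fixes Q :: "nat \<Rightarrow> ('e, 'k::field) mpoly set"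
  assumes "finite X"
    and prime: "\<And>i. i \<le> n \<Longrightarrow> primeideal (Q i) (mpoly_ring X)"
    and chain: "\<And>i. i < n \<Longrightarrow> Q i \<subset> Q (Suc i)"
  shows "n \<le> card {e \<in> X. mpoly_var e \<notin> Q 0}"
proof -
  define F where "F = {e \<in> X. mpoly_var e \<notin> Q 0}"
  have "\<exists>f. \<forall>i<n. f i \<in> Q (Suc i) - Q i"
    using chain by (intro choice allI) (metis DiffI psubset_imp_ex_mem)
  then obtain f where f: "\<And>i. i < n \<Longrightarrow> f i \<in> Q (Suc i) - Q i"
    by auto
  define cut :: "('e, 'k) mpoly \<Rightarrow> ('e, 'k) mpoly" where
    "cut p = (\<Sum>t | t \<in> Poly_Mapping.keys p \<and> Poly_Mapping.keys t \<subseteq> F.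
                Poly_Mapping.single t (Poly_Mapping.lookup p t))" for p
  have Q0: "Q 0 \<subseteq> Q i" if "i \<le> n" for i
    using that
  proof (induction i)
    case (Suc i)
    then show ?case using chain[of i] by auto
  qed simp
  have cut_diff: "p - cut p \<in> Q 0" if p: "p \<in> carrier (mpoly_ring X)" for p
  proof -
    have "p = (\<Sum>t\<in>Poly_Mapping.keys p. Poly_Mapping.single t (Poly_Mapping.lookup p t))"
      by (rule poly_mapping_eq_sum_single)
    also have "\<dots> = (\<Sum>t\<in>Poly_Mapping.keys p - {t \<in> Poly_Mapping.keys p. Poly_Mapping.keys t \<subseteq> F}.
                      Poly_Mapping.single t (Poly_Mapping.lookup p t)) + cut p"
      unfolding cut_def by (rule sum.subset_diff) auto
    finally have "p - cut p = (\<Sum>t\<in>Poly_Mapping.keys p - {t \<in> Poly_Mapping.keys p. Poly_Mapping.keys t \<subseteq> F}.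
                      Poly_Mapping.single t (Poly_Mapping.lookup p t))"
      by (simp add: algebra_simps)
    also have "\<dots> \<in> Q 0"
    proof (rule mpoly_primeideal_sum[OF prime])
      fix t assume t: "t \<in> Poly_Mapping.keys p - {t \<in> Poly_Mapping.keys p. Poly_Mapping.keys t \<subseteq> F}"
      then have "Poly_Mapping.keys t \<subseteq> X"
        using p by (auto simp: mpoly_ring_simps)
      moreover from this t obtain e where "e \<in> Poly_Mapping.keys t" "mpoly_var e \<in> Q 0"
        by (auto simp: F_def)
      ultimately show "Poly_Mapping.single t (Poly_Mapping.lookup p t) \<in> Q 0"
        by (intro mpoly_primeideal_monomial[OF prime]) auto
    qed auto
    finally show ?thesis .
  qed
  have "n \<le> card F"
  proof (rule prime_chain_length_le[OF prime, where f = "\<lambda>i. cut (f i)"])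
    fix i assume i: "i < n"
    note P = prime[of i] and P' = prime[of "Suc i"]
    have "f i \<in> carrier (mpoly_ring X)"
      using f[OF i] mpoly_primeideal_subset[OF P'] i by auto
    then have "f i - cut (f i) \<in> Q i" "f i - cut (f i) \<in> Q (Suc i)"
      using cut_diff Q0[of i] Q0[of "Suc i"] i by auto
    then show "cut (f i) \<in> Q (Suc i) - Q i"
      using f[OF i] mpoly_primeideal_diff[OF P', of "f i" "f i - cut (f i)"] i
        mpoly_primeideal_add[OF P, of "f i - cut (f i)" "cut (f i)"] by auto
  next
    fix i
    show "\<forall>t\<in>Poly_Mapping.keys (cut (f i)). Poly_Mapping.keys t \<subseteq> F"
      using keys_sum_subset by (fastforce simp: cut_def split: if_splits)
  qed (use chain \<open>finite X\<close> in \<open>auto simp: F_def\<close>)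
  then show ?thesis
    by (simp add: F_def)
qed

text \<open>
  Makes up for the integral domain instance of polynomial mappings, which needs a linear order on
  the monomials and hence does not apply to variables of an arbitrary type.
\<close>

lemma unique_sum_exists:
  fixes S T :: "('e \<Rightarrow>\<^sub>0 nat) set"
  assumes "finite Y" "finite S" "S \<noteq> {}" "finite T" "T \<noteq> {}"
    and "\<And>s s' e. s \<in> S \<Longrightarrow> s' \<in> S \<Longrightarrow> e \<notin> Y \<Longrightarrow> Poly_Mapping.lookup s e = Poly_Mapping.lookup s' e"
    and "\<And>t t' e. t \<in> T \<Longrightarrow> t' \<in> T \<Longrightarrow> e \<notin> Y \<Longrightarrow> Poly_Mapping.lookup t e = Poly_Mapping.lookup t' e"
  shows "\<exists>s0\<in>S. \<exists>t0\<in>T. \<forall>s\<in>S. \<forall>t\<in>T. s + t = s0 + t0 \<longrightarrow> s = s0 \<and> t = t0"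
  using assms
proof (induction Y arbitrary: S T rule: finite_induct)
  case empty
  then have "s = s'" if "s \<in> S" "s' \<in> S" for s s'
    using that by (intro poly_mapping_eqI) blast
  moreover have "t = t'" if "t \<in> T" "t' \<in> T" for t t'
    using empty that by (intro poly_mapping_eqI) blast
  ultimately show ?case
    using empty by blast
next
  case (insert x Y)
  define a where "a = Max ((\<lambda>s. Poly_Mapping.lookup s x) ` S)"
  define b where "b = Max ((\<lambda>t. Poly_Mapping.lookup t x) ` T)"
  have a: "Poly_Mapping.lookup s x \<le> a" if "s \<in> S" for s
    using that insert.prems by (auto simp: a_def)
  have b: "Poly_Mapping.lookup t x \<le> b" if "t \<in> T" for t
    using that insert.prems by (auto simp: b_def)
  \<comment> \<open>Exponents at \<open>x\<close> add up to \<open>a + b\<close> only if both are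
    maximal, so every competing pair already lies in \<open>S'\<close> and \<open>T'\<close>. There
    \<open>x\<close> no longer varies, and induction applies.\<close>
  define S' where "S' = {s \<in> S. Poly_Mapping.lookup s x = a}"
  define T' where "T' = {t \<in> T. Poly_Mapping.lookup t x = b}"
  have "a \<in> (\<lambda>s. Poly_Mapping.lookup s x) ` S" "b \<in> (\<lambda>t. Poly_Mapping.lookup t x) ` T"
    unfolding a_def b_def using insert.prems by (auto intro!: Max_in)
  then have "S' \<noteq> {}" "T' \<noteq> {}"
    by (auto simp: S'_def T'_def)
  have "\<exists>s0\<in>S'. \<exists>t0\<in>T'. \<forall>s\<in>S'. \<forall>t\<in>T'. s + t = s0 + t0 \<longrightarrow> s = s0 \<and> t = t0"
  proof (rule insert.IH)
    fix s s' e assume "s \<in> S'" "s' \<in> S'" "e \<notin> Y"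
    then show "Poly_Mapping.lookup s e = Poly_Mapping.lookup s' e"
      using insert.prems(5)[of s s' e] by (cases "e = x") (auto simp: S'_def)
  next
    fix t t' e assume "t \<in> T'" "t' \<in> T'" "e \<notin> Y"
    then show "Poly_Mapping.lookup t e = Poly_Mapping.lookup t' e"
      using insert.prems(6)[of t t' e] by (cases "e = x") (auto simp: T'_def)
  qed (use insert.prems \<open>S' \<noteq> {}\<close> \<open>T' \<noteq> {}\<close> in \<open>auto simp: S'_def T'_def\<close>)
  then obtain s0 t0 where 0: "s0 \<in> S'" "t0 \<in> T'"
    and uniq: "\<And>s t. s \<in> S' \<Longrightarrow> t \<in> T' \<Longrightarrow> s + t = s0 + t0 \<Longrightarrow> s = s0 \<and> t = t0"
    by blast
  have "s = s0 \<and> t = t0" if st: "s \<in> S" "t \<in> T" "s + t = s0 + t0" for s t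
  proof -
    have "Poly_Mapping.lookup s x + Poly_Mapping.lookup t x = a + b"
      using arg_cong[OF st(3), of "\<lambda>u. Poly_Mapping.lookup u x"] 0
      by (simp add: lookup_add S'_def T'_def)
    then have "s \<in> S'" "t \<in> T'"
      using a[OF st(1)] b[OF st(2)] st by (auto simp: S'_def T'_def)
    then show ?thesis using uniq st by blast
  qed
  then show ?case
    using 0 by (auto simp: S'_def T'_def)
qed

text \<open>The ideal generated by the variables in \<open>X\<close> outside \<open>F\<close>,
  described by its monomials so that membership can be read off from the support.\<close>

definition face_ideal :: "'e set \<Rightarrow> 'e set \<Rightarrow> ('e, 'k::field) mpoly set" where
  "face_ideal X F =
     {p \<in> carrier (mpoly_ring X). \<forall>t\<in>Poly_Mapping.keys p. \<not> Poly_Mapping.keys t \<subseteq> F}"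

lemma lookup_mult_eq:
  fixes p q :: "('e, 'k::field) mpoly"
  shows "Poly_Mapping.lookup (p * q) u =
     (\<Sum>s\<in>Poly_Mapping.keys p. \<Sum>t\<in>Poly_Mapping.keys q.
        if s + t = u then Poly_Mapping.lookup p s * Poly_Mapping.lookup q t else 0)"
proof -
  have "p * q =
      (\<Sum>s\<in>Poly_Mapping.keys p. Poly_Mapping.single s (Poly_Mapping.lookup p s)) *
      (\<Sum>t\<in>Poly_Mapping.keys q. Poly_Mapping.single t (Poly_Mapping.lookup q t))"
    by (simp flip: poly_mapping_eq_sum_single)
  then show ?thesis
    by (simp add: sum_product mult_single lookup_sum lookup_single when_def)
qed

text \<open>If neither factor is in the ideal, both have monomials supported in \<open>F\<close>.
  Some sum of two of these arises in only one way, so its coefficient in the product is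
  nonzero.\<close>

lemma primeideal_face_ideal:
  assumes "finite F"
  shows "primeideal (face_ideal X F :: ('e, 'k::field) mpoly set) (mpoly_ring X)"
proof (rule primeidealI)
  interpret cring "mpoly_ring X :: ('e, 'k) mpoly ring"
    by (rule cring_mpoly_ring)
  show "cring (mpoly_ring X :: ('e, 'k) mpoly ring)"
    by (rule cring_mpoly_ring)
  have mult: "p * q \<in> face_ideal X F" if "p \<in> face_ideal X F" "q \<in> carrier (mpoly_ring X)"
    for p q :: "('e, 'k) mpoly"
    using that by (auto simp: face_ideal_def mpoly_carrier_mult keys_add_nat elim!: keys_mult_exponents)
  show "ideal (face_ideal X F :: ('e, 'k) mpoly set) (mpoly_ring X)"
  proof (rule idealI)
    show "subgroup (face_ideal X F :: ('e, 'k) mpoly set) (add_monoid (mpoly_ring X))"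
    proof (rule add.subgroupI)
      show "face_ideal X F \<noteq> ({} :: ('e, 'k) mpoly set)"
        by (auto simp: face_ideal_def mpoly_carrier_0 intro!: exI[of _ 0])
      fix p q :: "('e, 'k) mpoly"
      assume p: "p \<in> face_ideal X F"
      then have "\<ominus>\<^bsub>mpoly_ring X\<^esub> p = - p"
        by (intro minus_equality) (auto simp: face_ideal_def mpoly_ring_simps(2-) mpoly_carrier_uminus)
      then show "\<ominus>\<^bsub>mpoly_ring X\<^esub> p \<in> face_ideal X F"
        using p by (auto simp: face_ideal_def keys_uminus_mpoly mpoly_carrier_uminus)
      assume "q \<in> face_ideal X F"
      then show "p \<oplus>\<^bsub>mpoly_ring X\<^esub> q \<in> face_ideal X F"
        using p Poly_Mapping.keys_add[of p q]
        by (auto simp: face_ideal_def mpoly_ring_simps(2-) mpoly_carrier_add)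
    qed (auto simp: face_ideal_def)
  qed (use mult ring_axioms in \<open>auto simp: mpoly_ring_simps(2-) mult.commute\<close>)
  have "(1 :: ('e, 'k) mpoly) \<notin> face_ideal X F"
    by (auto simp: face_ideal_def)
  then show "carrier (mpoly_ring X) \<noteq> (face_ideal X F :: ('e, 'k) mpoly set)"
    using mpoly_carrier_1 by metis
  fix p q :: "('e, 'k) mpoly"
  assume pq: "p \<in> carrier (mpoly_ring X)" "q \<in> carrier (mpoly_ring X)"
    "p \<otimes>\<^bsub>mpoly_ring X\<^esub> q \<in> face_ideal X F"
  show "p \<in> face_ideal X F \<or> q \<in> face_ideal X F"
  proof (rule ccontr)
    assume contr: "\<not> (p \<in> face_ideal X F \<or> q \<in> face_ideal X F)"
    define S where "S = {s \<in> Poly_Mapping.keys p. Poly_Mapping.keys s \<subseteq> F}"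
    define T where "T = {t \<in> Poly_Mapping.keys q. Poly_Mapping.keys t \<subseteq> F}"
    have "S \<noteq> {}" "T \<noteq> {}"
      using contr pq by (auto simp: face_ideal_def S_def T_def)
    have zero: "Poly_Mapping.lookup s e = 0" if "s \<in> S \<union> T" "e \<notin> F" for s e
      using that by (auto simp: S_def T_def in_keys_iff subset_iff)
    have "\<exists>s0\<in>S. \<exists>t0\<in>T. \<forall>s\<in>S. \<forall>t\<in>T. s + t = s0 + t0 \<longrightarrow> s = s0 \<and> t = t0"
      using \<open>S \<noteq> {}\<close> \<open>T \<noteq> {}\<close> zero
      by (intro unique_sum_exists[OF \<open>finite F\<close>]) (auto simp: S_def T_def)
    then obtain s0 t0 where 0: "s0 \<in> S" "t0 \<in> T"
      and uniq: "\<And>s t. s \<in> S \<Longrightarrow> t \<in> T \<Longrightarrow> s + t = s0 + t0 \<Longrightarrow> s = s0 \<and> t = t0"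
      by blast
    have F0: "Poly_Mapping.keys (s0 + t0) \<subseteq> F"
      using 0 by (auto simp: keys_add_nat S_def T_def)
    \<comment> \<open>When a sum of exponents is supported in \<open>F\<close>, so are both
      summands; terms outside \<open>S\<close> and \<open>T\<close> cannot interfere.\<close>
    have only: "s + t = s0 + t0 \<longleftrightarrow> s = s0 \<and> t = t0"
      if "s \<in> Poly_Mapping.keys p" "t \<in> Poly_Mapping.keys q" for s t
    proof
      assume eq: "s + t = s0 + t0"
      then have "Poly_Mapping.keys s \<subseteq> F" "Poly_Mapping.keys t \<subseteq> F"
        using F0 by (metis keys_add_nat Un_subset_iff)+
      then show "s = s0 \<and> t = t0"
        using uniq eq that by (auto simp: S_def T_def)
    qed auto
    have "Poly_Mapping.lookup (p * q) (s0 + t0) =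
        (\<Sum>s\<in>Poly_Mapping.keys p. \<Sum>t\<in>Poly_Mapping.keys q.
          if s = s0 then if t = t0 then Poly_Mapping.lookup p s * Poly_Mapping.lookup q t else 0 else 0)"
      unfolding lookup_mult_eq by (intro sum.cong refl) (auto simp: only)
    also have "\<dots> = (\<Sum>s\<in>Poly_Mapping.keys p. if s = s0 then
          (\<Sum>t\<in>Poly_Mapping.keys q. if t = t0 then Poly_Mapping.lookup p s * Poly_Mapping.lookup q t else 0) else 0)"
      by (intro sum.cong refl) auto
    also have "\<dots> = Poly_Mapping.lookup p s0 * Poly_Mapping.lookup q t0"
      using 0 by (simp add: S_def T_def)
    also have "\<dots> \<noteq> 0"
      using 0 by (simp add: S_def T_def in_keys_iff)
    finally have "s0 + t0 \<in> Poly_Mapping.keys (p * q)"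
      by (simp add: in_keys_iff)
    then show False
      using pq(3) F0 by (auto simp: face_ideal_def mpoly_ring_simps(2-))
  qed
qed

section \<open>Prime ideals of a quotient ring\<close>

context cring
begin

text \<open>Members of \<open>P\<close> are cosets, so \<open>\<Union>P\<close> is the preimage of
  \<open>P\<close> under the projection.\<close>

lemma primeideal_quot_vimage:
  assumes "ideal I R" "primeideal P (R Quot I)"
  shows "primeideal (\<Union>P) R" "I \<subseteq> \<Union>P"
proof -
  interpret I: ideal I R by fact
  interpret P: primeideal P "R Quot I" by fact
  have "\<Union>P = {x \<in> carrier R. I +> x \<in> P}"
    using canonical_proj_vimage_in_carrier[OF assms(1) P.a_subset]
      canonical_proj_vimage_mem_iff[OF assms(1) P.a_subset] by blast
  then show "primeideal (\<Union>P) R"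
    using ring_hom_ring.primeideal_vimage[OF I.rcos_ring_hom_ring is_cring assms(2)] by simp
  have "I \<in> P"
    using additive_subgroup.zero_closed[OF ideal.axioms(1)[OF P.is_ideal]] by (simp add: FactRing_def)
  then show "I \<subseteq> \<Union>P" by auto
qed

text \<open>Projecting the union of an ideal of the quotient gives this ideal back, so distinct
  ideals have distinct unions.\<close>

lemma ideal_quot_Union_strict_mono:
  assumes "ideal I R" "ideal P (R Quot I)" "ideal P' (R Quot I)" "P \<subset> P'"
  shows "\<Union>P \<subset> \<Union>P'"
proof -
  have "(+>) I ` \<Union>J = J" if "ideal J (R Quot I)" for J
  proof -
    have "J \<in> (\<lambda>K. (+>) I ` K) ` {K. ideal K R \<and> I \<subseteq> K}"
      using bij_betw_imp_surj_on[OF quot_ideal_correspondence[OF assms(1)]] that by simp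
    then obtain K where K: "ideal K R" "I \<subseteq> K" "J = (+>) I ` K"
      by auto
    then have "\<Union>J = K"
      using ideal_incl_iff[OF assms(1) K(1)] by simp
    then show ?thesis using K by simp
  qed
  then show ?thesis
    using assms by (metis Union_mono psubsetE psubsetI)
qed

text \<open>As \<open>I \<subseteq> P\<close>, a coset belongs to the image exactly if its
  representative belongs to \<open>P\<close>, and primality carries over.\<close>

lemma primeideal_quot_image:
  assumes "ideal I R" "primeideal P R" "I \<subseteq> P"
  shows "primeideal ((+>) I ` P) (R Quot I)"
proof -
  interpret I: ideal I R by fact
  interpret P: primeideal P R by fact
  have UN: "\<Union>((+>) I ` P) = P"
    using ideal_incl_iff[OF assms(1) P.is_ideal] assms(3) by blast
  have id: "ideal ((+>) I ` P) (R Quot I)"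
    by (rule ring_ideal_imp_quot_ideal[OF assms(1) P.is_ideal])
  have mem: "I +> x \<in> (+>) I ` P \<longleftrightarrow> x \<in> P" if "x \<in> carrier R" for x
    using canonical_proj_vimage_mem_iff[OF assms(1) additive_subgroup.a_subset[OF ideal.axioms(1)[OF id]] that]
    by (simp add: UN)
  have carr: "carrier (R Quot I) = (+>) I ` carrier R"
    by (auto simp: FactRing_def A_RCOSETS_def')
  show ?thesis
  proof (rule primeidealI[OF id])
    show "cring (R Quot I)"
      by (rule I.quotient_is_cring[OF is_cring])
    obtain x where "x \<in> carrier R" "x \<notin> P"
      using P.I_notcarr P.a_subset by blast
    then have "I +> x \<in> carrier (R Quot I)" "I +> x \<notin> (+>) I ` P"
      by (simp_all add: mem) (simp add: carr)
    then show "carrier (R Quot I) \<noteq> (+>) I ` P"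
      by metis
  next
    fix a b
    assume carr_ab: "a \<in> carrier (R Quot I)" "b \<in> carrier (R Quot I)"
      and ab: "a \<otimes>\<^bsub>R Quot I\<^esub> b \<in> (+>) I ` P"
    obtain x where x: "x \<in> carrier R" "a = I +> x"
      using carr_ab(1) unfolding carr by (rule imageE)
    obtain y where y: "y \<in> carrier R" "b = I +> y"
      using carr_ab(2) unfolding carr by (rule imageE)
    note xy = x y
    have "a \<otimes>\<^bsub>R Quot I\<^esub> b = I +> (x \<otimes> y)"
      by (simp add: FactRing_def I.rcoset_mult_add xy)
    then have "x \<otimes> y \<in> P"
      using ab mem xy by simp
    then show "a \<in> (+>) I ` P \<or> b \<in> (+>) I ` P"
      using P.I_prime xy by blast
  qed
qed

end

section \<open>The Krull dimension of the Stanley--Reisner ring\<close>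

lemma (in cring) quot_image_strict_mono:
  assumes "ideal I R" "ideal P R" "ideal P' R" "I \<subseteq> P" "P \<subset> P'"
  shows "(+>) I ` P \<subset> (+>) I ` P'"
proof -
  have "\<Union>((+>) I ` J) = J" if "ideal J R" "I \<subseteq> J" for J
    using ideal_incl_iff[OF assms(1) that(1)] that(2) by simp
  from this[OF assms(2)] this[OF assms(3)] show ?thesis
    using assms(4,5) by (metis image_mono psubsetE psubsetI subset_trans)
qed

lemma mpoly_var_in_face_ideal:
  "(mpoly_var e :: ('e, 'k::field) mpoly) \<in> face_ideal X F \<longleftrightarrow> e \<in> X \<and> e \<notin> F"
  by (auto simp: face_ideal_def mpoly_ring_simps mpoly_var_def)

lemma face_ideal_strict_antimono:
  assumes "F \<subset> F'" "F' \<subseteq> X"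
  shows "(face_ideal X F' :: ('e, 'k::field) mpoly set) \<subset> face_ideal X F"
proof
  show "(face_ideal X F' :: ('e, 'k) mpoly set) \<subseteq> face_ideal X F"
    using assms unfolding face_ideal_def by blast
  obtain e where "e \<in> F'" "e \<notin> F"
    using assms by blast
  then show "(face_ideal X F' :: ('e, 'k) mpoly set) \<noteq> face_ideal X F"
    using assms mpoly_var_in_face_ideal by (metis subsetD)
qed

section \<open>Primes over the Stanley-Reisner ideal\<close>

context
  fixes V :: "'a set" and E :: "'a set set" and r :: "'a set rel"
  assumes G: "simple_graph V E" and r: "linear_order_on E r"
begin

lemma bc_generators_subset:
  "(\<lambda>B. \<Prod>e\<in>B. (mpoly_var e :: ('a set, 'k::field) mpoly)) ` broken_circuits V E r
     \<subseteq> carrier (mpoly_ring E)"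
  using broken_circuit_subset[OF G r] by (auto intro!: mpoly_carrier_prod mpoly_carrier_var)

lemma ideal_bc_ideal: "ideal (bc_ideal V E r :: ('a set, 'k::field) mpoly set) (mpoly_ring E)"
  unfolding bc_ideal_def
  by (rule ring.genideal_ideal[OF cring.axioms(1)[OF cring_mpoly_ring] bc_generators_subset])

lemma bc_generator_in_ideal:
  "B \<in> broken_circuits V E r \<Longrightarrow>
     (\<Prod>e\<in>B. mpoly_var e) \<in> (bc_ideal V E r :: ('a set, 'k::field) mpoly set)"
  using ring.genideal_self[OF cring.axioms(1)[OF cring_mpoly_ring] bc_generators_subset]
  unfolding bc_ideal_def by blast

text \<open>A prime that contains the monomial of a broken circuit contains one of its
  variables.\<close>

lemma face_of_primeideal:
  fixes Q :: "('a set, 'k::field) mpoly set"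
  assumes Q: "primeideal Q (mpoly_ring E)" and "bc_ideal V E r \<subseteq> Q"
  shows "{e \<in> E. mpoly_var e \<notin> Q} \<in> bc_complex V E r"
  unfolding bc_complex_def
proof (intro CollectI conjI ballI notI)
  fix B assume B: "B \<in> broken_circuits V E r" "B \<subseteq> {e \<in> E. mpoly_var e \<notin> Q}"
  have "finite B"
    using finite_subset[OF broken_circuit_subset[OF G r B(1)] simple_graph_finite_edges[OF G]] .
  moreover have "(\<Prod>e\<in>B. mpoly_var e) \<in> Q"
    using bc_generator_in_ideal[OF B(1)] assms(2) by blast
  moreover have "mpoly_var e \<in> carrier (mpoly_ring E)" if "e \<in> B" for e
    using that B(2) by (intro mpoly_carrier_var) auto
  ultimately obtain e where "e \<in> B" "mpoly_var e \<in> Q"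
    using mpoly_primeideal_prod[OF Q, of B mpoly_var] by auto
  then show False using B by auto
qed auto

text \<open>No broken circuit lies inside a face, so each generator has a variable outside
  \<open>F\<close>.\<close>

lemma bc_ideal_subset_face_ideal:
  assumes "F \<in> bc_complex V E r"
  shows "bc_ideal V E r \<subseteq> (face_ideal E F :: ('a set, 'k::field) mpoly set)"
  unfolding bc_ideal_def
proof (rule ring.genideal_minimal[OF cring.axioms(1)[OF cring_mpoly_ring]])
  have "finite F"
    using assms finite_subset[OF _ simple_graph_finite_edges[OF G], of F] by (simp add: bc_complex_def)
  then have prime: "primeideal (face_ideal E F :: ('a set, 'k) mpoly set) (mpoly_ring E)"
    by (rule primeideal_face_ideal)
  then show "ideal (face_ideal E F :: ('a set, 'k) mpoly set) (mpoly_ring E)"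
    by (rule primeideal.axioms(1))
  show "(\<lambda>B. \<Prod>e\<in>B. mpoly_var e) ` broken_circuits V E r \<subseteq> (face_ideal E F :: ('a set, 'k) mpoly set)"
  proof clarify
    fix B assume B: "B \<in> broken_circuits V E r"
    then obtain e where e: "e \<in> B" "e \<notin> F"
      using assms by (auto simp: bc_complex_def)
    have "B \<subseteq> E"
      by (rule broken_circuit_subset[OF G r B])
    then have "finite B"
      using finite_subset simple_graph_finite_edges[OF G] by blast
    then have "(\<Prod>e\<in>B. mpoly_var e :: ('a set, 'k) mpoly) = (\<Prod>e\<in>B - {e}. mpoly_var e) * mpoly_var e"
      using e by (simp add: prod.remove mult.commute)
    also have "\<dots> \<in> face_ideal E F"
      using e \<open>B \<subseteq> E\<close>
      by (intro mpoly_primeideal_mult[OF prime] mpoly_carrier_prod mpoly_carrier_var)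
        (auto simp: mpoly_var_in_face_ideal)
    finally show "(\<Prod>e\<in>B. mpoly_var e :: ('a set, 'k) mpoly) \<in> face_ideal E F" .
  qed
qed

text \<open>Unions turn the chain into a strict chain of primes of the polynomial ring. Its length
  is at most the number of variables outside the first prime, and these form a face.\<close>

lemma bc_ring_prime_chain_length:
  fixes P :: "nat \<Rightarrow> ('a set, 'k::field) mpoly set set"
  assumes "V \<noteq> {}"
    and prime: "\<And>i. i \<le> n \<Longrightarrow> primeideal (P i) (bc_ring V E r)"
    and chain: "\<And>i. i < n \<Longrightarrow> P i \<subset> P (Suc i)"
  shows "n < card V"
proof -
  interpret R: cring "mpoly_ring E :: ('a set, 'k) mpoly ring"
    by (rule cring_mpoly_ring)
  note quot = R.primeideal_quot_vimage[OF ideal_bc_ideal prime[unfolded bc_ring_def]]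
  have "n \<le> card {e \<in> E. mpoly_var e \<notin> \<Union>(P 0)}"
  proof (rule mpoly_ring_prime_chain_length[OF simple_graph_finite_edges[OF G], where Q = "\<lambda>i. \<Union>(P i)"])
    fix i assume "i < n"
    then show "\<Union>(P i) \<subset> \<Union>(P (Suc i))"
      using chain prime[unfolded bc_ring_def]
      by (intro R.ideal_quot_Union_strict_mono[OF ideal_bc_ideal])
        (auto intro: primeideal.axioms(1))
  qed (rule quot(1))
  also have "\<dots> < card V"
    using card_face_less[OF G r \<open>V \<noteq> {}\<close> face_of_primeideal] quot[of 0] by blast
  finally show ?thesis .
qed

lemma bc_ring_prime_chain_exists:
  assumes "connected_graph V E"
  shows "\<exists>P :: nat \<Rightarrow> ('a set, 'k::field) mpoly set set.
    (\<forall>i\<le>card V - 1. primeideal (P i) (bc_ring V E r)) \<and> (\<forall>i<card V - 1. P i \<subset> P (Suc i))"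
proof -
  interpret R: cring "mpoly_ring E :: ('a set, 'k) mpoly ring"
    by (rule cring_mpoly_ring)
  let ?I = "bc_ideal V E r :: ('a set, 'k) mpoly set"
  obtain F where F: "F \<in> bc_complex V E r" "card V \<le> Suc (card F)"
    using exists_spanning_face[OF G r assms] by blast
  have "F \<subseteq> E"
    using F(1) by (simp add: bc_complex_def)
  then have "finite F"
    using finite_subset simple_graph_finite_edges[OF G] by blast
  then obtain h where h: "bij_betw h {0..<card F} F"
    using ex_bij_betw_nat_finite by blast
  define n where "n = card V - 1"
  \<comment> \<open>Edges of the spanning face are dropped one at a time, from
    \<open>card V - 1\<close> edges at \<open>S 0\<close> down to none at \<open>S n\<close>; the
    face ideals grow accordingly.\<close>
  define S where "S i = h ` {0..<n - i}" for i
  have S: "S i \<subseteq> F" for i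
    using h F(2) by (auto simp: S_def n_def bij_betw_def)
  define Q :: "nat \<Rightarrow> ('a set, 'k) mpoly set" where "Q i = face_ideal E (S i)" for i
  have prime: "primeideal (Q i) (mpoly_ring E)" for i
    unfolding Q_def by (rule primeideal_face_ideal) (simp add: S_def)
  have I: "?I \<subseteq> Q i" for i
    unfolding Q_def by (rule bc_ideal_subset_face_ideal[OF bc_complex_down_closed[OF G r F(1) S]])
  have "Q i \<subset> Q (Suc i)" if "i < n" for i
    unfolding Q_def
  proof (rule face_ideal_strict_antimono)
    have inj: "inj_on h {0..<n - i}"
      using h F(2) by (auto simp: bij_betw_def n_def intro: inj_on_subset)
    have "S (Suc i) \<subseteq> S i"
      by (auto simp: S_def)
    moreover have "card (S i) = n - i"
      by (simp add: S_def card_image[OF inj])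
    moreover have "card (S (Suc i)) \<le> n - Suc i"
      unfolding S_def using card_image_le[of "{0..<n - Suc i}" h] by simp
    ultimately show "S (Suc i) \<subset> S i"
      using that by auto
  qed (use S \<open>F \<subseteq> E\<close> in blast)
  then have "(+>\<^bsub>mpoly_ring E\<^esub>) ?I ` Q i \<subset> (+>\<^bsub>mpoly_ring E\<^esub>) ?I ` Q (Suc i)" if "i < n" for i
    using that I by (intro R.quot_image_strict_mono ideal_bc_ideal primeideal.axioms(1)[OF prime])
  then show ?thesis
    using R.primeideal_quot_image[OF ideal_bc_ideal prime I]
    by (intro exI[of _ "\<lambda>i. (+>\<^bsub>mpoly_ring E\<^esub>) ?I ` Q i"]) (simp add: bc_ring_def n_def)
qed

lemma krull_dim_bc_ring:
  assumes "connected_graph V E"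
  shows "krull_dim (bc_ring V E r :: ('a set, 'k::field) mpoly set ring) = ereal (real (card V) - 1)"
proof -
  have "V \<noteq> {}"
    using assms by (simp add: connected_graph_def)
  then have pos: "0 < card V"
    using simple_graph_finite_vertices[OF G] by (simp add: card_gt_0_iff)
  \<comment> \<open>Truncated subtraction is exact because \<open>V\<close> is nonempty.\<close>
  then have eq: "ereal (real (card V) - 1) = ereal (real (card V - 1))"
    by (simp add: of_nat_diff)
  show ?thesis
    unfolding krull_dim_def
  proof (rule antisym)
    show "Sup {ereal (real n) |n. \<exists>P. (\<forall>i\<le>n. primeideal (P i) (bc_ring V E r :: ('a set, 'k) mpoly set ring)) \<and>
        (\<forall>i<n. P i \<subset> P (Suc i))} \<le> ereal (real (card V) - 1)"
    proof (rule Sup_least, clarify)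
      fix n and P :: "nat \<Rightarrow> ('a set, 'k) mpoly set set"
      assume "\<forall>i\<le>n. primeideal (P i) (bc_ring V E r)" "\<forall>i<n. P i \<subset> P (Suc i)"
      then have "n < card V"
        using bc_ring_prime_chain_length[OF \<open>V \<noteq> {}\<close>, of n P] by blast
      then show "ereal (real n) \<le> ereal (real (card V) - 1)"
        unfolding eq by simp
    qed
  next
    show "ereal (real (card V) - 1) \<le> Sup {ereal (real n) |n.
        \<exists>P. (\<forall>i\<le>n. primeideal (P i) (bc_ring V E r :: ('a set, 'k) mpoly set ring)) \<and> (\<forall>i<n. P i \<subset> P (Suc i))}"
      unfolding eq using bc_ring_prime_chain_exists[OF assms] by (intro Sup_upper) blast
  qed
qed

end

section \<open>The coefficients and dimension for a strongly regular graph\<close>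

lemma gchoose_two: "(x :: real) gchoose 2 = x * (x - 1) / 2"
  by (simp add: gbinomial_prod_rev numeral_2_eq_2)

theorem theorem7p1:
  fixes V :: "'a set" and E :: "'a set set" and v k l m :: nat and r :: "'a set rel"
  assumes "strongly_regular_graph V E v k l m"
    and "nontrivial_graph V E"
    and "linear_order_on E r"
  shows "let \<beta> = real v * real k / 2 - real v + 1;
             h = h_polynomial V E r;
             R = (bc_ring V E r :: ('a set, 'k::field) mpoly set ring)
         in real_of_int (cycle_rank V E) = \<beta> \<and>
            poly.coeff h 0 = 1 \<and>
            real_of_int (poly.coeff h 1) = \<beta> \<and>
            real_of_int (poly.coeff h 2)
              = ((\<beta> + 1) gchoose 2) - real v * real k * real l / 6 \<and>
            krull_dim R = ereal (real v - 1) \<and>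
            ereal (real (card E)) - krull_dim R = ereal \<beta>"
proof -
  note G = srg_simple[OF assms(1)] and r = assms(3)
  define \<beta> where "\<beta> = real v * real k / 2 - real v + 1"
  have conn: "connected_graph V E"
    using assms(2) by (simp add: nontrivial_graph_def)
  have v: "card V = v" "3 \<le> v"
    using srg_card[OF assms(1)] nontrivial_graph_card_ge[OF G assms(2)] by auto
  have "2 * card E = v * k"
    using card_darts[OF G] srg_card_darts[OF assms(1)] by simp
  then have vk: "real v * real k = 2 * real (card E)"
    by (metis of_nat_mult of_nat_numeral)
  then have \<beta>: "\<beta> = real (card E) - real v + 1"
    by (simp add: \<beta>_def)
  let ?b = "\<lambda>i. card {F \<in> bc_complex V E r. card F = i}"
  have b0: "?b 0 = 1"
    by (simp only: faces_0[OF G r]) simp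
  have b1: "?b 1 = card E"
    using n_subsets[OF simple_graph_finite_edges[OF G], of 1] by (simp only: faces_1[OF G r]) simp
  define t where "t = card {B \<in> broken_circuits V E r. card B = 2}"
  have "t * 6 = v * k * l"
    unfolding t_def using card_broken_circuits_2[OF G r] srg_card_triangles[OF assms(1)] by simp
  then have t: "real t = real v * real k * real l / 6"
    by (metis nonzero_mult_div_cancel_right of_nat_mult of_nat_numeral zero_neq_numeral)
  have "real (?b 2) + real t = real (card E choose 2)"
    using card_faces_2[OF G r] unfolding t_def by (simp flip: of_nat_add)
  then have b2: "real (?b 2) = real (card E) * (real (card E) - 1) / 2 - real t"
    by (simp add: binomial_gbinomial gchoose_two eq_diff_eq)
  have h0: "poly.coeff (h_polynomial V E r) 0 = 1"
    using coeff_h_polynomial[OF G r, of 0] b0 by simp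
  have h1: "real_of_int (poly.coeff (h_polynomial V E r) 1) = \<beta>"
    using coeff_h_polynomial[OF G r, of 1] b0 b1 v by (simp add: \<beta> of_nat_diff)
  have ch: "real ((v - 1) choose 2) = (real v - 1) * (real v - 2) / 2"
    using v by (simp add: binomial_gbinomial gchoose_two of_nat_diff)
  have "2 \<le> card V - 1"
    using v by simp
  then have "poly.coeff (h_polynomial V E r) 2 =
      int ((v - 1) choose 2) - int (?b 1) * (int v - 2) + int (?b 2)"
    using coeff_h_polynomial[OF G r, of 2] b0 v
    by (simp add: numeral_2_eq_2 of_nat_diff algebra_simps)
  then have "real_of_int (poly.coeff (h_polynomial V E r) 2) =
      real ((v - 1) choose 2) - real (?b 1) * (real v - 2) + real (?b 2)"
    by simp
  \<comment> \<open>After inserting \<beta> as \<open>card E - v + 1\<close>, this is a polynomial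
    identity in \<open>card E\<close> and \<open>v\<close>; the triangles enter only through
    \<open>t\<close>.\<close>
  also have "\<dots> = (\<beta> + 1) * \<beta> / 2 - real t"
    unfolding b1 b2 ch \<beta> by (simp add: field_simps)
  also have "(\<beta> + 1) * \<beta> / 2 = (\<beta> + 1) gchoose 2"
    by (simp add: gchoose_two)
  finally have h2: "real_of_int (poly.coeff (h_polynomial V E r) 2) =
      ((\<beta> + 1) gchoose 2) - real v * real k * real l / 6"
    by (simp only: t)
  have rank: "real_of_int (cycle_rank V E) = \<beta>"
    using card_joined_classes[OF conn] v by (simp add: cycle_rank_def \<beta>)
  have dim: "krull_dim (bc_ring V E r :: ('a set, 'k) mpoly set ring) = ereal (real v - 1)"
    using krull_dim_bc_ring[OF G r conn] v by simp
  \<comment> \<open>The codimension is \<open>card E - (v - 1)\<close>, which is \<beta> by the edge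
    count.\<close>
  show ?thesis
    unfolding Let_def \<beta>_def[symmetric] using rank h0 h1 h2 dim by (simp add: \<beta>)
qed

end
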